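(* Every two-qubit unitary operation is deterministically implementable over the butterfly network.
   Context: The butterfly network has nodes $i_1,i_2,n_1,n_2,o_1,o_2$ and the seven edges $\{i_1,o_1\},\{i_1,n_1\},\{i_2,n_1\},\{i_2,o_2\},\{n_1,n_2\},\{n_2,o_1\},\{n_2,o_2\}$. The resource state is the tensor product over all edges of an EPR pair $(|00\rangle+|11\rangle)/\sqrt2$ with one qubit at each endpoint of the edge (each edge is a one-qubit quantum resource; classical communication between any nodes is unrestricted). Input qubits are located at $i_1$ and $i_2$, output qubits at $o_1$ and $o_2$. A two-qubit unitary $U$ is deterministically implementable over the network if some LOCC map $\Gamma$ (finitely many rounds of local operations each acting on systems at a single node, with unrestricted classical communication) maps $|\psi\rangle\langle\psi|\otimes|\Phi\rangle\langle\Phi|_{\mathcal R}$ to $U|\psi\rangle\langle\psi|U^\dagger$ on the output qubits for every pure two-qubit input state $|\psi\rangle$. *)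

theory Defs
  imports "Jordan_Normal_Form.Matrix"
begin

definition adj :: "complex mat \<Rightarrow> complex mat" where
  "adj A = mat (dim_col A) (dim_row A) (\<lambda>(i,j). cnj (A $$ (j,i)))"

definition kron :: "complex mat \<Rightarrow> complex mat \<Rightarrow> complex mat" where
  "kron A B = mat (dim_row A * dim_row B) (dim_col A * dim_col B)
     (\<lambda>(i,j). A $$ (i div dim_row B, j div dim_col B) * B $$ (i mod dim_row B, j mod dim_col B))"

definition unitary4 :: "complex mat \<Rightarrow> bool" where
  "unitary4 U \<longleftrightarrow> U \<in> carrier_mat 4 4 \<and> adj U * U = 1\<^sub>m 4 \<and> U * adj U = 1\<^sub>m 4"

definition proj :: "complex vec \<Rightarrow> complex mat" where
  "proj v = mat (dim_vec v) (dim_vec v) (\<lambda>(i,j). v $ i * cnj (v $ j))"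

text \<open>A multipartite system is described by the list ds of local dimensions, one entry
  per node (the Hilbert space of all systems held at that node); the global space is the
  tensor product in list order (first node most significant).
  An operator K acting at node v is embedded as identity on all other nodes.\<close>

definition embed :: "nat list \<Rightarrow> nat \<Rightarrow> complex mat \<Rightarrow> complex mat" where
  "embed ds v K = kron (kron (1\<^sub>m (prod_list (take v ds))) K) (1\<^sub>m (prod_list (drop (Suc v) ds)))"

text \<open>A finite-round LOCC protocol is a finite tree: at each step one node v applies a local
  quantum instrument with Kraus operators Ks (which may change the local dimension, thereby
  covering appending ancillas and discarding systems); the outcome j is broadcast and the
  protocol continues with the subprotocol (Qs j), chosen depending on all outcomes so far.\<close>

datatype protocol = Done | Step nat "complex mat list" "nat \<Rightarrow> protocol"

inductive valid :: "nat list \<Rightarrow> protocol \<Rightarrow> nat list \<Rightarrow> bool" where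
  valid_Done: "valid ds Done ds"
| valid_Step: "\<lbrakk> v < length ds; e > 0;
     \<forall>K \<in> set Ks. K \<in> carrier_mat e (ds ! v);
     foldr (+) (map (\<lambda>K. adj K * K) Ks) (0\<^sub>m (ds ! v) (ds ! v)) = 1\<^sub>m (ds ! v);
     \<forall>j < length Ks. valid (ds[v := e]) (Qs j) ds' \<rbrakk>
   \<Longrightarrow> valid ds (Step v Ks Qs) ds'"

text \<open>The overall (trace-preserving, deterministic) map implemented by a protocol: sum over
  all branches of the unnormalised post-measurement states.  ds' = final local dimensions.\<close>
primrec run :: "nat list \<Rightarrow> nat list \<Rightarrow> protocol \<Rightarrow> complex mat \<Rightarrow> complex mat" where
  "run ds' ds Done \<rho> = \<rho>"
| "run ds' ds (Step v Ks Qs) \<rho> =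
     foldr (+)
       (map (\<lambda>j. run ds' (ds[v := dim_row (Ks ! j)]) (Qs j)
                  (embed ds v (Ks ! j) * \<rho> * adj (embed ds v (Ks ! j))))
            [0..<length Ks])
       (0\<^sub>m (prod_list ds') (prod_list ds'))"

text \<open>Nodes in order: 0 = i1, 1 = i2, 2 = n1, 3 = n2, 4 = o1, 5 = o2.
  Qubits held at each node (within a node, listed from most significant):
   i1: input, half of {i1,o1}, half of {i1,n1}         (dim 8)
   i2: input, half of {i2,n1}, half of {i2,o2}         (dim 8)
   n1: half of {i1,n1}, half of {i2,n1}, half of {n1,n2} (dim 8)
   n2: half of {n1,n2}, half of {n2,o1}, half of {n2,o2} (dim 8)
   o1: half of {i1,o1}, half of {n2,o1}                 (dim 4)
   o2: half of {i2,o2}, half of {n2,o2}                 (dim 4)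
  Hence the global computational basis index is a 16-bit string whose qubit positions
  (0 = most significant) are: i1: 0,1,2; i2: 3,4,5; n1: 6,7,8; n2: 9,10,11; o1: 12,13;
  o2: 14,15.  The input qubits are positions 0 (at i1) and 3 (at i2).\<close>

definition butterfly_dims :: "nat list" where
  "butterfly_dims = [8, 8, 8, 8, 4, 4]"

text \<open>At the end only the output qubits remain: one qubit at o1 and one at o2, all other
  nodes have discarded their systems (dimension 1).\<close>
definition output_dims :: "nat list" where
  "output_dims = [1, 1, 1, 1, 2, 2]"

text \<open>The seven EPR pairs as pairs of qubit positions:
  {i1,o1}: (1,12), {i1,n1}: (2,6), {i2,n1}: (4,7), {i2,o2}: (5,14),
  {n1,n2}: (8,9), {n2,o1}: (10,13), {n2,o2}: (11,15).\<close>
definition epr_positions :: "(nat \<times> nat) list" where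
  "epr_positions = [(1,12), (2,6), (4,7), (5,14), (8,9), (10,13), (11,15)]"

definition qbit :: "nat \<Rightarrow> nat \<Rightarrow> nat" where
  "qbit x k = (x div 2 ^ (15 - k)) mod 2"

text \<open>Global state vector psi (input, qubit at i1 most significant) tensor the resource state.\<close>
definition butterfly_init :: "complex vec \<Rightarrow> complex vec" where
  "butterfly_init \<psi> = vec (2 ^ 16) (\<lambda>x.
      \<psi> $ (2 * qbit x 0 + qbit x 3) *
      (if (\<forall>(a,b) \<in> set epr_positions. qbit x a = qbit x b)
       then (1 / complex_of_real (sqrt 2)) ^ 7 else 0))"

definition deterministically_implementable :: "complex mat \<Rightarrow> bool" where
  "deterministically_implementable U \<longleftrightarrow>
     (\<exists>P. valid butterfly_dims P output_dims \<and>
        (\<forall>\<psi> \<in> carrier_vec 4. (\<Sum>i<4. cmod (\<psi> $ i) ^ 2) = 1 \<longrightarrow>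
           run output_dims butterfly_dims P (proj (butterfly_init \<psi>))
             = U * proj \<psi> * adj U))"

end

theory Submission
  imports Defs "Jordan_Normal_Form.Spectral_Radius"
begin

text \<open>
  By the Cartan decomposition, \<open>U = (A \<otimes> B) N (C \<otimes> D)\<close> with \<open>N\<close> diagonal in the Bell basis: in the
  magic basis the local unitaries are generated by real Givens rotations, the symmetric unitary
  \<open>W\<^sup>T W\<close> is diagonalised by such rotations since its eigenvectors can be chosen real, and what
  remains is real orthogonal. Local factors cost nothing.

  The phase that \<open>N\<close> assigns to a Bell state depends on its \<open>ZZ\<close> parity \<open>s\<close> and its \<open>XX\<close> parity \<open>t\<close>.
  Each input node copies the \<open>Z\<close> value of its qubit along both of its edges; \<open>n\<^sub>1\<close> forwards only the
  parity \<open>s\<close> of the two copies to \<open>n\<^sub>2\<close>. Each output node copies the \<open>X\<close> value of the qubit it received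
  to \<open>n\<^sub>2\<close>, which thus holds \<open>s\<close> and two bits of parity \<open>t\<close>, applies the phase, and erases the three
  copies by measuring them in the complementary basis. All outcomes are equally likely, and the resulting
  Pauli errors are undone locally at the output nodes.
\<close>

text \<open>The edge {n1,n2} carries one qubit, so \<open>n2\<close> can never hold the two-qubit
  state itself; only \<open>s\<close> fits through the bottleneck. The complementary bit has to come
  back from the output nodes over {n2,o1} and {n2,o2}. Since ZZ and XX commute, both parities can be
  available at \<open>n2\<close> at once without disturbing the state.

  Erasing a copy leaves a sign, and the construction works because each such sign factors over the
  two outputs. For \<open>n1\<close> and for the two X copies this is clear. The copy of
  \<open>s\<close> leaves (-1)^(w1 s); as \<open>N\<close> preserves \<open>s\<close>, this is also
  the parity of the outgoing Z values, so it splits into two local signs.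

  The channel is a sum over all branches. Every branch stays pure and is followed as one amplitude
  function of the bits. There are 14 measured bits, and every branch ends in the same vector with
  factor \<open>root_half ^ 14\<close>.

  On the algebraic side determinants are avoided: rotations only clear the first three columns of a
  real orthogonal matrix, and the sign that may remain is diagonal and is absorbed into
  \<open>N\<close>.\<close>

section \<open>Local operations on tensor product vectors\<close>

text \<open>The leading digit is not reduced modulo its base, so \<open>digits ds i\<close> is meaningful only for
  \<open>i < prod_list ds\<close>.\<close>

fun digits :: "nat list \<Rightarrow> nat \<Rightarrow> nat list" where
  "digits [] i = []"
| "digits (d # ds) i = (i div prod_list ds) # digits ds (i mod prod_list ds)"

definition tensor_vec :: "nat list \<Rightarrow> (nat list \<Rightarrow> complex) \<Rightarrow> complex vec" where
  "tensor_vec ds f = vec (prod_list ds) (\<lambda>i. f (digits ds i))"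

lemma length_digits [simp]: "length (digits ds i) = length ds"
  by (induction ds arbitrary: i) auto

lemma digits_append:
  assumes "i < prod_list (ds @ es)"
  shows "digits (ds @ es) i = digits ds (i div prod_list es) @ digits es (i mod prod_list es)"
  using assms
proof (induction ds arbitrary: i)
  case (Cons d ds)
  have "i mod (prod_list ds * prod_list es) div prod_list es = i div prod_list es mod prod_list ds"
  proof -
    have "i mod (p * q) div q = i div q mod p" for p q
      using mod_mult2_eq[of i q p] by (cases "q = 0") (simp_all add: mult.commute)
    then show ?thesis .
  qed
  moreover have "i mod (prod_list ds * prod_list es) mod prod_list es = i mod prod_list es"
    by (simp add: mod_mod_cancel)
  moreover have "i mod prod_list (ds @ es) < prod_list (ds @ es)"
    using Cons.prems by (metis gr0I mod_less_divisor mult_0_right not_less0 append_Cons prod_list.Cons)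
  ultimately show ?case
    using Cons.IH[of "i mod prod_list (ds @ es)"]
    by (simp add: div_mult2_eq[symmetric] mult.commute)
qed simp

lemma digits_less:
  assumes "i < prod_list ds"
  shows "list_all2 (<) (digits ds i) ds"
  using assms
proof (induction ds arbitrary: i)
  case (Cons d ds)
  then have "0 < prod_list ds"
    by (metis gr0I mult_0_right not_less0 prod_list.Cons)
  with Cons show ?case by (simp add: less_mult_imp_div_less)
qed auto

lemma tensor_vec_cong:
  assumes "\<And>xs. list_all2 (<) xs ds \<Longrightarrow> f xs = g xs"
  shows "tensor_vec ds f = tensor_vec ds g"
  unfolding tensor_vec_def using assms digits_less by (intro eq_vecI) auto

lemma dim_tensor_vec [simp]: "dim_vec (tensor_vec ds f) = prod_list ds"
  by (simp add: tensor_vec_def)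

lemma embed_index:
  assumes "v < length ds" "K \<in> carrier_mat e (ds ! v)"
  defines "p \<equiv> prod_list (take v ds)" and "q \<equiv> prod_list (drop (Suc v) ds)"
  assumes "i < p * e * q" "j < p * ds ! v * q"
  shows "embed ds v K $$ (i, j) =
    (if i div q div e = j div q div (ds ! v) \<and> i mod q = j mod q
     then K $$ (i div q mod e, j div q mod (ds ! v)) else 0)"
proof -
  have "0 < q" "0 < e" "0 < ds ! v"
    using assms(5,6) by (metis gr0I mult_0_right mult_0 not_less0)+
  moreover have "i div q < p * e" "j div q < p * ds ! v"
    using assms(5,6) by (simp_all add: less_mult_imp_div_less)
  ultimately show ?thesis
    using assms(1,2,5,6)
    by (auto simp: embed_def kron_def p_def[symmetric] q_def[symmetric] less_mult_imp_div_less)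
qed

lemma embed_dims:
  assumes "v < length ds" "K \<in> carrier_mat e (ds ! v)"
  shows "embed ds v K \<in> carrier_mat (prod_list (ds[v := e])) (prod_list ds)"
proof -
  have "prod_list ds = prod_list (take v ds) * ds ! v * prod_list (drop (Suc v) ds)"
    using assms by (metis id_take_nth_drop prod_list.append prod_list.Cons mult.assoc)
  then show ?thesis
    using assms by (auto simp: embed_def kron_def upd_conv_take_nth_drop)
qed

text \<open>An operator at node \<open>v\<close> touches digit \<open>v\<close> only. Through this
  formula every protocol step becomes a sum over one digit of an amplitude function, and no matrix
  on the global space has to be computed.\<close>

lemma embed_mult_tensor_vec:
  assumes v: "v < length ds" and K: "K \<in> carrier_mat e (ds ! v)"
  shows "embed ds v K *\<^sub>v tensor_vec ds f =
    tensor_vec (ds[v := e]) (\<lambda>xs. \<Sum>k < ds ! v. K $$ (xs ! v, k) * f (xs[v := k]))"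
proof (rule eq_vecI)
  define pre d post where "pre = take v ds" and "d = ds ! v" and "post = drop (Suc v) ds"
  define p q where "p = prod_list pre" and "q = prod_list post"
  have ds: "ds = pre @ d # post" and lpre: "length pre = v"
    using v by (auto simp: pre_def d_def post_def id_take_nth_drop)
  have dse: "ds[v := e] = pre @ e # post"
    by (simp add: ds lpre[symmetric])
  have pd: "prod_list ds = p * d * q" and pe: "prod_list (ds[v := e]) = p * e * q"
    by (simp_all only: dse) (simp_all add: ds p_def q_def mult.assoc)
  have dig: "digits (pre @ c # post) (x * q + b) = digits pre (x div c) @ (x mod c) # digits post b"
    if "b < q" "x < p * c" for c x b
  proof -
    have "Suc x * q \<le> p * c * q" using that by (intro mult_right_mono) auto
    then have "x * q + b < prod_list (pre @ c # post)"
      using that by (simp add: p_def q_def mult.assoc)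
    moreover
    have "(x * q + b) div q = x" "(x * q + b) mod q = b"
      using that by simp_all
    then have "(x * q + b) mod (c * q) = (x mod c) * q + b" "(x * q + b) div (c * q) = x div c"
      using mod_mult2_eq[of "x * q + b" q c] div_mult2_eq[of "x * q + b" q c]
      by (simp_all add: mult.commute)
    ultimately show ?thesis
      using that by (simp add: digits_append q_def[symmetric])
  qed
  fix i assume "i < dim_vec (tensor_vec (ds[v := e]) (\<lambda>xs. \<Sum>k < ds ! v. K $$ (xs ! v, k) * f (xs[v := k])))"
  then have i: "i < p * e * q" by (simp add: pe)
  then have q: "0 < q" and e: "0 < e" by (metis gr0I mult_0_right mult_0 not_less0)+
  define a r b where "a = i div q div e" and "r = i div q mod e" and "b = i mod q"
  have b: "b < q" and r: "r < e" using q e by (auto simp: b_def r_def)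
  have a: "a < p" using i by (simp add: a_def less_mult_imp_div_less)
  have i_eq: "i = (a * e + r) * q + b" by (simp add: a_def r_def b_def)
  \<comment> \<open>\<open>h k\<close> is the column index that shares all digits with row
    \<open>i\<close>, except that digit \<open>v\<close> is \<open>k\<close>. By
    \<open>embed_index\<close> only these columns contribute.\<close>
  define h where "h = (\<lambda>k. (a * d + k) * q + b)"
  have ltp: "a * c + k < p * c" if "k < c" for k c
  proof -
    have "a * c + k < Suc a * c" using that by simp
    also have "\<dots> \<le> p * c" using a by (intro mult_right_mono) auto
    finally show ?thesis .
  qed
  have lt: "h k < p * d * q" if "k < d" for k
  proof -
    from ltp[OF that] have "Suc (a * d + k) * q \<le> p * d * q" by (intro mult_right_mono) auto
    then show ?thesis using b by (simp add: h_def)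
  qed
  have digi: "digits (ds[v := e]) i = digits pre a @ r # digits post b"
    unfolding dse i_eq using dig[OF b ltp[OF r]] r by simp
  have digh: "digits ds (h k) = digits pre a @ k # digits post b" if "k < d" for k
    unfolding ds h_def using dig[OF b ltp[OF that]] that by simp
  have hq: "h k div q = a * d + k" "h k mod q = b" for k
    using b q by (auto simp: h_def)
  have "(embed ds v K *\<^sub>v tensor_vec ds f) $ i
      = (\<Sum>j < p * d * q. embed ds v K $$ (i, j) * tensor_vec ds f $ j)"
    using i embed_dims[OF v K] pd pe
    by (auto simp: scalar_prod_def atLeast0LessThan carrier_matD intro!: sum.cong)
  also have "\<dots> = (\<Sum>j \<in> {j. j < p * d * q \<and> j div q div d = a \<and> j mod q = b}.
      K $$ (r, j div q mod d) * f (digits ds j))"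
    using i
    by (intro sum.mono_neutral_cong_right)
      (auto simp: embed_index[OF v K] tensor_vec_def pd p_def q_def pre_def post_def d_def a_def b_def r_def)
  also have "\<dots> = (\<Sum>k < d. K $$ (r, k) * f (digits pre a @ k # digits post b))"
  proof (rule sum.reindex_bij_witness[where i = h and j = "\<lambda>j. j div q mod d"])
    fix j assume j: "j \<in> {j. j < p * d * q \<and> j div q div d = a \<and> j mod q = b}"
    then have d: "0 < d" by (metis (mono_tags, lifting) gr0I mult_0_right mult_0 not_less0 mem_Collect_eq)
    then show "j div q mod d \<in> {..<d}" by simp
    from j show hj: "h (j div q mod d) = j"
      unfolding h_def by (metis (mono_tags, lifting) div_mult_mod_eq mem_Collect_eq)
    from digh[of "j div q mod d"] hj d
    show "K $$ (r, j div q mod d) * f (digits pre a @ (j div q mod d) # digits post b) =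
      K $$ (r, j div q mod d) * f (digits ds j)" by simp
  qed (use lt in \<open>auto simp: hq\<close>)
  finally show "(embed ds v K *\<^sub>v tensor_vec ds f) $ i =
      tensor_vec (ds[v := e]) (\<lambda>xs. \<Sum>k < ds ! v. K $$ (xs ! v, k) * f (xs[v := k])) $ i"
    using i lpre by (simp add: tensor_vec_def pe digi nth_append list_update_append flip: d_def)
next
  show "dim_vec (embed ds v K *\<^sub>v tensor_vec ds f) =
    dim_vec (tensor_vec (ds[v := e]) (\<lambda>xs. \<Sum>k < ds ! v. K $$ (xs ! v, k) * f (xs[v := k])))"
    using embed_dims[OF v K] by auto
qed

section \<open>Protocol steps: completeness and the sum over outcomes\<close>

lemma foldr_plus_mat_carrier:
  assumes "\<And>x. x \<in> set xs \<Longrightarrow> F x \<in> carrier_mat n m"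
  shows "foldr (+) (map F xs) (0\<^sub>m n m) \<in> carrier_mat n m"
  using assms by (induction xs) auto

lemma foldr_plus_mat_index:
  assumes "\<And>x. x \<in> set xs \<Longrightarrow> F x \<in> carrier_mat n m" "i < n" "j < m"
  shows "foldr (+) (map F xs) (0\<^sub>m n m) $$ (i, j) = (\<Sum>x\<leftarrow>xs. F x $$ (i, j))"
  using assms(1)
proof (induction xs)
  case (Cons x xs)
  then have "foldr (+) (map F xs) (0\<^sub>m n m) \<in> carrier_mat n m"
    by (intro foldr_plus_mat_carrier) auto
  with Cons assms(2,3) show ?case by auto
qed (use assms(2,3) in simp)

lemma conj_proj:
  assumes "A \<in> carrier_mat n (dim_vec x)"
  shows "A * proj x * adj A = proj (A *\<^sub>v x)"
proof (rule eq_matI)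
  fix i j assume "i < dim_row (proj (A *\<^sub>v x))" "j < dim_col (proj (A *\<^sub>v x))"
  then have ij: "i < n" "j < n" using assms by (auto simp: proj_def)
  let ?m = "dim_vec x"
  have "(A * proj x * adj A) $$ (i, j)
      = (\<Sum>l<?m. (\<Sum>k<?m. A $$ (i, k) * (x $ k * cnj (x $ l))) * cnj (A $$ (j, l)))"
    using assms ij by (auto simp: scalar_prod_def proj_def adj_def atLeast0LessThan intro!: sum.cong)
  also have "\<dots> = (\<Sum>k<?m. A $$ (i, k) * x $ k) * cnj (\<Sum>l<?m. A $$ (j, l) * x $ l)"
    by (simp add: cnj_sum sum_distrib_left sum_distrib_right mult_ac)
  also have "\<dots> = proj (A *\<^sub>v x) $$ (i, j)"
    using assms ij by (auto simp: scalar_prod_def proj_def atLeast0LessThan)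
  finally show "(A * proj x * adj A) $$ (i, j) = proj (A *\<^sub>v x) $$ (i, j)" .
qed (use assms in \<open>auto simp: proj_def adj_def\<close>)

definition kraus_step ::
  "nat \<Rightarrow> nat \<Rightarrow> nat \<Rightarrow> nat \<Rightarrow> (nat \<Rightarrow> nat \<Rightarrow> nat \<Rightarrow> complex) \<Rightarrow> (nat \<Rightarrow> protocol) \<Rightarrow> protocol" where
  "kraus_step v n e d f Q = Step v (map (\<lambda>j. mat e d (\<lambda>(r, k). f j r k)) [0..<n]) Q"

lemma valid_kraus_step:
  assumes "v < length ds" "ds ! v = d" "0 < e"
    and complete: "\<And>k l. k < d \<Longrightarrow> l < d \<Longrightarrow>
      (\<Sum>j<n. \<Sum>r<e. cnj (f j r k) * f j r l) = (if k = l then 1 else 0)"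
    and "\<And>j. j < n \<Longrightarrow> valid (ds[v := e]) (Q j) ds'"
  shows "valid ds (kraus_step v n e d f Q) ds'"
  unfolding kraus_step_def
proof (rule valid_Step[OF assms(1,3)])
  let ?K = "\<lambda>j. mat e d (\<lambda>(r, k). f j r k)"
  have car: "adj (?K j) * ?K j \<in> carrier_mat d d" for j
    by (auto simp: adj_def)
  have "foldr (+) (map (\<lambda>j. adj (?K j) * ?K j) [0..<n]) (0\<^sub>m d d) = 1\<^sub>m d" (is "?S = _")
  proof (rule eq_matI)
    fix k l assume "k < dim_row (1\<^sub>m d :: complex mat)" "l < dim_col (1\<^sub>m d :: complex mat)"
    then have kl: "k < d" "l < d" by auto
    then have "?S $$ (k, l) = (\<Sum>j\<leftarrow>[0..<n]. (adj (?K j) * ?K j) $$ (k, l))"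
      using car by (intro foldr_plus_mat_index) auto
    also have "\<dots> = (\<Sum>j<n. \<Sum>r<e. cnj (f j r k) * f j r l)"
      using kl by (simp add: interv_sum_list_conv_sum_set_nat atLeast0LessThan scalar_prod_def adj_def)
    finally show "?S $$ (k, l) = 1\<^sub>m d $$ (k, l)"
      using kl complete by simp
  qed (use foldr_plus_mat_carrier[of "[0..<n]" "\<lambda>j. adj (?K j) * ?K j" d d, OF car] in auto)
  then show "foldr (+) (map (\<lambda>K. adj K * K) (map ?K [0..<n])) (0\<^sub>m (ds ! v) (ds ! v)) = 1\<^sub>m (ds ! v)"
    using assms(2) by (simp add: o_def)
qed (use assms in auto)

lemma foldr_plus_mat_const:
  fixes T :: "complex mat"
  assumes T: "T \<in> carrier_mat n m" and "\<And>x. x \<in> set xs \<Longrightarrow> F x = c \<cdot>\<^sub>m T"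
  shows "foldr (+) (map F xs) (0\<^sub>m n m) = (of_nat (length xs) * c) \<cdot>\<^sub>m T"
  using assms(2)
proof (induction xs)
  case Nil
  then show ?case using T by (intro eq_matI) auto
next
  case (Cons x xs)
  then show ?case using T by (intro eq_matI) (auto simp: algebra_simps)
qed

text \<open>A Kraus operator keeps a branch pure, so the state is always \<open>proj\<close> of an
  amplitude function. When all branches end in the same multiple of \<open>T\<close>, the sum over
  outcomes merely counts them. The premise \<open>branch\<close> allows a closed form
  \<open>G j\<close> to replace the raw sum.\<close>

lemma run_kraus_step:
  assumes "v < length ds" "ds ! v = d"
    and T: "T \<in> carrier_mat (prod_list ds') (prod_list ds')"
    and branch: "\<And>j. j < n \<Longrightarrow>
      tensor_vec (ds[v := e]) (\<lambda>xs. \<Sum>k<d. f j (xs ! v) k * F (xs[v := k])) = tensor_vec (ds[v := e]) (G j)"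
    and rest: "\<And>j. j < n \<Longrightarrow>
      run ds' (ds[v := e]) (Q j) (proj (tensor_vec (ds[v := e]) (G j))) = c \<cdot>\<^sub>m T"
  shows "run ds' ds (kraus_step v n e d f Q) (proj (tensor_vec ds F)) = (of_nat n * c) \<cdot>\<^sub>m T"
proof -
  let ?K = "\<lambda>j. mat e d (\<lambda>(r, k). f j r k)"
  have K: "?K j \<in> carrier_mat e (ds ! v)" for j using assms(2) by auto
  have emb: "embed ds v (?K j) * proj (tensor_vec ds F) * adj (embed ds v (?K j))
      = proj (tensor_vec (ds[v := e]) (G j))" if "j < n" for j
  proof -
    have "embed ds v (?K j) *\<^sub>v tensor_vec ds F =
      tensor_vec (ds[v := e]) (\<lambda>xs. \<Sum>k<d. ?K j $$ (xs ! v, k) * F (xs[v := k]))"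
      using embed_mult_tensor_vec[OF assms(1) K, of j F] assms(2) by simp
    also have "\<dots> = tensor_vec (ds[v := e]) (\<lambda>xs. \<Sum>k<d. f j (xs ! v) k * F (xs[v := k]))"
    proof (rule tensor_vec_cong, rule sum.cong, rule refl)
      fix xs k assume "list_all2 (<) xs (ds[v := e])" "k \<in> {..<d}"
      moreover from this have "xs ! v < e"
        using assms(1) by (metis list_all2_nthD2 length_list_update nth_list_update_eq)
      ultimately show "?K j $$ (xs ! v, k) * F (xs[v := k]) = f j (xs ! v) k * F (xs[v := k])" by simp
    qed
    finally show ?thesis
      using branch[OF that] embed_dims[OF assms(1) K, of j] by (subst conj_proj) auto
  qed
  have "run ds' ds (kraus_step v n e d f Q) (proj (tensor_vec ds F)) =
    foldr (+) (map (\<lambda>j. run ds' (ds[v := e]) (Q j) (proj (tensor_vec (ds[v := e]) (G j)))) [0..<n])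
      (0\<^sub>m (prod_list ds') (prod_list ds'))"
    unfolding kraus_step_def
    by (auto simp: emb intro!: arg_cong[where f = "\<lambda>xs. foldr (+) xs _"])
  also have "\<dots> = (of_nat (length [0..<n]) * c) \<cdot>\<^sub>m T"
    using T rest by (intro foldr_plus_mat_const) auto
  finally show ?thesis by simp
qed

section \<open>The Kraus operators of the protocol\<close>

lemma sum_bits3:
  "(\<Sum>k<8. g (bit (k::nat) 2) (bit k 1) (bit k 0)) = (\<Sum>x\<in>UNIV. \<Sum>y\<in>UNIV. \<Sum>z\<in>UNIV. g x y z)"
  for g :: "bool \<Rightarrow> bool \<Rightarrow> bool \<Rightarrow> complex"
proof -
  have "{..<8::nat} = {0, 1, 2, 3, 4, 5, 6, 7}" by auto
  then show ?thesis by (simp add: UNIV_bool bit_iff_odd)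
qed

lemma eq_iff_bits1:
  assumes "k < 2" "l < 2"
  shows "k = l \<longleftrightarrow> bit (k::nat) 0 = bit l 0"
proof -
  have "k \<in> {0, 1}" "l \<in> {0, 1}" using assms by auto
  then show ?thesis by (auto simp: bit_iff_odd)
qed

lemma eq_iff_bits2:
  assumes "k < 4" "l < 4"
  shows "k = l \<longleftrightarrow> bit (k::nat) 1 = bit l 1 \<and> bit k 0 = bit l 0"
proof -
  have "k \<in> {0, 1, 2, 3}" "l \<in> {0, 1, 2, 3}" using assms by auto
  then show ?thesis by (auto simp: bit_iff_odd)
qed

lemma eq_iff_bits3:
  assumes "k < 8" "l < 8"
  shows "k = l \<longleftrightarrow> bit (k::nat) 2 = bit l 2 \<and> bit k 1 = bit l 1 \<and> bit k 0 = bit l 0"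
proof -
  have "k \<in> {0, 1, 2, 3, 4, 5, 6, 7}" "l \<in> {0, 1, 2, 3, 4, 5, 6, 7}" using assms by auto
  then show ?thesis by (auto simp: bit_iff_odd)
qed

definition sgn_bit :: "bool \<Rightarrow> complex" where
  "sgn_bit b = (if b then -1 else 1)"

definition root_half :: complex where
  "root_half = 1 / complex_of_real (sqrt 2)"

lemma root_half_sq [simp]: "root_half * root_half = 1 / 2" "root_half * (root_half * x) = x / 2"
proof -
  show *: "root_half * root_half = 1 / 2"
    unfolding root_half_def by (simp flip: of_real_mult)
  show "root_half * (root_half * x) = x / 2"
    unfolding mult.assoc[symmetric] * by simp
qed

lemma cnj_root_half [simp]: "cnj root_half = root_half"
  by (simp add: root_half_def)

definition unitary_bit :: "(bool \<Rightarrow> bool \<Rightarrow> complex) \<Rightarrow> bool" where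
  "unitary_bit A \<longleftrightarrow> (\<forall>a b. (\<Sum>r\<in>UNIV. cnj (A r a) * A r b) = (if a = b then 1 else 0))"

lemma unitary_bitD:
  assumes "unitary_bit A"
  shows "cnj (A False False) * A False False + cnj (A True False) * A True False = 1"
    "cnj (A False True) * A False True + cnj (A True True) * A True True = 1"
    "cnj (A False True) * A False False + cnj (A True True) * A True False = 0"
    "cnj (A False False) * A False True + cnj (A True False) * A True True = 0"
  using assms by (auto simp: unitary_bit_def UNIV_bool all_bool_eq)

text \<open>The first arguments of a Kraus operator are classical data: earlier outcomes, whose Pauli errors
  are compensated by shifting bits, and then the outcome of the step. They are followed by the row (at
  the output nodes) and the basis bits of the node, most significant first. Since \<open>kraus_in\<close> is symmetric
  in its two edges, it does not matter that \<open>i\<^sub>1\<close> and \<open>i\<^sub>2\<close> store them in opposite orders.\<close>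

definition kraus_in ::
  "(bool \<Rightarrow> bool \<Rightarrow> complex) \<Rightarrow> bool \<Rightarrow> bool \<Rightarrow> bool \<Rightarrow> bool \<Rightarrow> bool \<Rightarrow> bool \<Rightarrow> complex" where
  "kraus_in C m1 m2 m3 a e1 e2 =
    (if (e1 \<noteq> m1) = (e2 \<noteq> m2) then root_half * sgn_bit ((e1 \<noteq> m1) \<and> m3) * C (e1 \<noteq> m1) a else 0)"

text \<open>\<open>z\<close> is measured relative to the parity of the two corrected copies, with
  outcome \<open>m\<close>; the copies are measured in the X basis, with outcomes \<open>p\<close>
  and \<open>q\<close>. The signs with \<open>m3\<close> and \<open>l3\<close> cancel the phase
  errors left by the input nodes; those with \<open>p\<close> and \<open>q\<close> are left to the
  output nodes.\<close>

definition kraus_n1 ::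
  "bool \<Rightarrow> bool \<Rightarrow> bool \<Rightarrow> bool \<Rightarrow> bool \<Rightarrow> bool \<Rightarrow> bool \<Rightarrow> bool \<Rightarrow> bool \<Rightarrow> bool \<Rightarrow> complex" where
  "kraus_n1 m2 m3 l1 l3 p q m x y z =
    (if z = (((x \<noteq> m2) \<noteq> (y \<noteq> l1)) \<noteq> m)
     then sgn_bit ((x \<noteq> m2) \<and> p) * sgn_bit ((x \<noteq> m2) \<and> m3) *
       (sgn_bit ((y \<noteq> l1) \<and> q) * sgn_bit ((y \<noteq> l1) \<and> l3)) / 2 else 0)"

text \<open>A Hadamard transform turns the received qubit into its X value \<open>u\<close>.
  Consuming \<open>e\<close> with outcome \<open>r\<close> makes the other half of that pair, at
  \<open>n2\<close>, equal to \<open>u\<close> up to the flip \<open>r\<close>. The sign with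
  \<open>p\<close> undoes the phase error caused by the measurement at \<open>n1\<close>.\<close>

definition kraus_out ::
  "bool \<Rightarrow> bool \<Rightarrow> bool \<Rightarrow> bool \<Rightarrow> bool \<Rightarrow> bool \<Rightarrow> complex" where
  "kraus_out m p r u x e =
    (if e = (u \<noteq> r) then root_half * sgn_bit (u \<and> (x \<noteq> m)) * sgn_bit (p \<and> (x \<noteq> m)) else 0)"

definition kraus_n2 ::
  "(bool \<Rightarrow> bool \<Rightarrow> complex) \<Rightarrow> bool \<Rightarrow> bool \<Rightarrow> bool \<Rightarrow> bool \<Rightarrow> bool \<Rightarrow> bool \<Rightarrow> bool \<Rightarrow> bool \<Rightarrow> bool \<Rightarrow> complex" where
  "kraus_n2 d m r t w1 w2 w3 x y z =
    root_half / 2 * (sgn_bit (w1 \<and> (x \<noteq> m)) * sgn_bit (w2 \<and> (y \<noteq> r)) * sgn_bit (w3 \<and> (z \<noteq> t))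
      * d (x \<noteq> m) ((y \<noteq> r) \<noteq> (z \<noteq> t)))"

text \<open>The sum over \<open>b\<close> is the Hadamard transform back to Z values. The sign with
  \<open>w2\<close> undoes the erasure of this node's X copy, and the sign with \<open>w1\<close> is
  its share of (-1)^(w1 s).\<close>

definition kraus_final ::
  "(bool \<Rightarrow> bool \<Rightarrow> complex) \<Rightarrow> bool \<Rightarrow> bool \<Rightarrow> bool \<Rightarrow> bool \<Rightarrow> complex" where
  "kraus_final A w1 w2 c u =
    root_half * (\<Sum>b\<in>UNIV. A c b * sgn_bit (b \<and> u) * sgn_bit (w2 \<and> u) * sgn_bit (w1 \<and> b))"

lemma kraus_in_complete:
  assumes "unitary_bit C"
  shows "(\<Sum>m1\<in>UNIV. \<Sum>m2\<in>UNIV. \<Sum>m3\<in>UNIV.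
      cnj (kraus_in C m1 m2 m3 a e1 e2) * kraus_in C m1 m2 m3 a' e1' e2') =
    (if a = a' \<and> e1 = e1' \<and> e2 = e2' then 1 else 0)"
  using unitary_bitD[OF assms]
  by (cases a; cases e1; cases e2; cases a'; cases e1'; cases e2')
    (simp_all add: kraus_in_def UNIV_bool sgn_bit_def algebra_simps flip: add_divide_distrib)

lemma kraus_n1_complete:
  "(\<Sum>p\<in>UNIV. \<Sum>q\<in>UNIV. \<Sum>m\<in>UNIV.
      cnj (kraus_n1 m2 m3 l1 l3 p q m x y z) * kraus_n1 m2 m3 l1 l3 p q m x' y' z') =
    (if x = x' \<and> y = y' \<and> z = z' then 1 else 0)"
  by (cases "x = m2"; cases "x' = m2"; cases "y = l1"; cases "y' = l1"; cases m3; cases l3)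
    (auto simp: kraus_n1_def UNIV_bool sgn_bit_def)

lemma kraus_out_complete:
  "(\<Sum>r\<in>UNIV. \<Sum>u\<in>UNIV. cnj (kraus_out m p r u x e) * kraus_out m p r u x' e') =
    (if x = x' \<and> e = e' then 1 else 0)"
  by (cases m; cases p; cases x; cases x'; cases e; cases e')
    (auto simp: kraus_out_def UNIV_bool sgn_bit_def)

text \<open>Orthogonality of characters on each of the three bits kills the off-diagonal terms; on
  the diagonal the phases cancel because \<open>d\<close> has modulus one.\<close>

lemma kraus_n2_complete:
  assumes "\<And>s t. cnj (d s t) * d s t = 1"
  shows "(\<Sum>w1\<in>UNIV. \<Sum>w2\<in>UNIV. \<Sum>w3\<in>UNIV.
      cnj (kraus_n2 d m r t w1 w2 w3 x y z) * kraus_n2 d m r t w1 w2 w3 x' y' z') =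
    (if x = x' \<and> y = y' \<and> z = z' then 1 else 0)"
  (is "?L = _")
proof -
  have char: "(\<Sum>w\<in>UNIV. sgn_bit (w \<and> b) * sgn_bit (w \<and> c)) = (if b = c then 2 else 0)" for b c
    by (cases b; cases c) (auto simp: UNIV_bool sgn_bit_def)
  have real: "cnj (sgn_bit b) = sgn_bit b" for b by (simp add: sgn_bit_def)
  have "?L = (\<Sum>w\<in>UNIV. sgn_bit (w \<and> (x \<noteq> m)) * sgn_bit (w \<and> (x' \<noteq> m)))
    * (\<Sum>w\<in>UNIV. sgn_bit (w \<and> (y \<noteq> r)) * sgn_bit (w \<and> (y' \<noteq> r)))
    * (\<Sum>w\<in>UNIV. sgn_bit (w \<and> (z \<noteq> t)) * sgn_bit (w \<and> (z' \<noteq> t)))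
    * (cnj (d (x \<noteq> m) ((y \<noteq> r) \<noteq> (z \<noteq> t))) * d (x' \<noteq> m) ((y' \<noteq> r) \<noteq> (z' \<noteq> t))) / 8"
    unfolding kraus_n2_def
    by (simp add: UNIV_bool real algebra_simps add_divide_distrib)
  then show ?thesis
    unfolding char using assms by auto
qed

lemma kraus_final_complete:
  assumes "unitary_bit A"
  shows "(\<Sum>c\<in>UNIV. cnj (kraus_final A w1 w2 c u) * kraus_final A w1 w2 c u') =
    (if u = u' then 1 else 0)"
  (is "?L = _")
proof -
  have real: "cnj (sgn_bit b) = sgn_bit b" for b by (simp add: sgn_bit_def)
  have "?L = (\<Sum>b\<in>UNIV. \<Sum>b'\<in>UNIV.
      sgn_bit (b \<and> u) * sgn_bit (w2 \<and> u) * sgn_bit (w1 \<and> b) *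
      sgn_bit (b' \<and> u') * sgn_bit (w2 \<and> u') * sgn_bit (w1 \<and> b') *
      (\<Sum>c\<in>UNIV. cnj (A c b) * A c b')) / 2"
    unfolding kraus_final_def by (simp add: UNIV_bool real algebra_simps add_divide_distrib)
  also have "\<dots> = (\<Sum>b\<in>UNIV. \<Sum>b'\<in>UNIV.
      sgn_bit (b \<and> u) * sgn_bit (w2 \<and> u) * sgn_bit (w1 \<and> b) *
      sgn_bit (b' \<and> u') * sgn_bit (w2 \<and> u') * sgn_bit (w1 \<and> b') *
      (if b = b' then 1 else 0)) / 2"
    using assms unfolding unitary_bit_def by presburger
  also have "\<dots> = (if u = u' then 1 else 0)"
    by (cases u; cases u'; cases w2; cases w1) (simp_all add: UNIV_bool sgn_bit_def)
  finally show ?thesis .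
qed

section \<open>Amplitudes during the protocol\<close>

lemma sum_less2: "(\<Sum>k<2. g (k::nat)) = g 0 + (g 1 :: complex)"
  by (simp add: numeral_eq_Suc)

lemma sum_less4: "(\<Sum>k<4. g (k::nat)) = g 0 + g 1 + g 2 + (g 3 :: complex)"
  by (simp add: numeral_eq_Suc)

lemma sum_less8:
  "(\<Sum>k<8. g (k::nat)) = g 0 + g 1 + g 2 + g 3 + g 4 + g 5 + g 6 + (g 7 :: complex)"
  by (simp add: numeral_eq_Suc)

lemma bit_evals:
  "\<not> bit (0::nat) n" "bit (1::nat) 0" "\<not> bit (1::nat) 1" "\<not> bit (1::nat) 2"
  "bit (Suc 0) 0" "\<not> bit (Suc 0) (Suc 0)" "\<not> bit (1::nat) (Suc 0)" "\<not> bit (Suc 0) 2"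
  "\<not> bit (2::nat) 0" "bit (2::nat) 1" "bit (2::nat) (Suc 0)" "\<not> bit (2::nat) 2"
  "bit (3::nat) 0" "bit (3::nat) 1" "bit (3::nat) (Suc 0)" "\<not> bit (3::nat) 2"
  "\<not> bit (4::nat) 0" "\<not> bit (4::nat) 1" "\<not> bit (4::nat) (Suc 0)" "bit (4::nat) 2"
  "bit (5::nat) 0" "\<not> bit (5::nat) 1" "\<not> bit (5::nat) (Suc 0)" "bit (5::nat) 2"
  "\<not> bit (6::nat) 0" "bit (6::nat) 1" "bit (6::nat) (Suc 0)" "bit (6::nat) 2"
  "bit (7::nat) 0" "bit (7::nat) 1" "bit (7::nat) (Suc 0)" "bit (7::nat) 2"
  by (simp_all add: bit_iff_odd)

definition amp_init :: "(bool \<Rightarrow> bool \<Rightarrow> complex) \<Rightarrow> nat list \<Rightarrow> complex" where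
  "amp_init \<psi> xs =
    (if bit (xs ! 0) 1 = bit (xs ! 4) 1 \<and> bit (xs ! 0) 0 = bit (xs ! 2) 2 \<and>
        bit (xs ! 1) 1 = bit (xs ! 2) 1 \<and> bit (xs ! 1) 0 = bit (xs ! 5) 1 \<and>
        bit (xs ! 2) 0 = bit (xs ! 3) 2 \<and> bit (xs ! 3) 1 = bit (xs ! 4) 0 \<and>
        bit (xs ! 3) 0 = bit (xs ! 5) 0
     then root_half ^ 7 * \<psi> (bit (xs ! 0) 2) (bit (xs ! 1) 2) else 0)"

definition bit_amp :: "complex vec \<Rightarrow> bool \<Rightarrow> bool \<Rightarrow> complex" where
  "bit_amp v a b = v $ (2 * of_bool a + of_bool b)"

lemma bit_amp_simps:
  "bit_amp v False False = v $ 0" "bit_amp v False True = v $ 1"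
  "bit_amp v True False = v $ 2" "bit_amp v True True = v $ 3"
  by (simp_all add: bit_amp_def)

lemma butterfly_init_eq:
  "butterfly_init \<psi> = tensor_vec butterfly_dims (amp_init (bit_amp \<psi>))"
proof -
  have md: "bit (n mod 2 ^ a div 2 ^ b) k \<longleftrightarrow> b + k < a \<and> bit n (b + k)" for n a b k :: nat
    by (simp add: bit_take_bit_iff bit_drop_bit_eq flip: take_bit_eq_mod drop_bit_eq_div)
  have d: "bit (n div 2 ^ b) k \<longleftrightarrow> bit n (b + k)" for n b k :: nat
    by (simp add: bit_drop_bit_eq flip: drop_bit_eq_div)
  have m: "bit (n mod 2 ^ a) k \<longleftrightarrow> k < a \<and> bit n k" for n a k :: nat
    by (simp add: bit_take_bit_iff flip: take_bit_eq_mod)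
  have q: "qbit x k = of_bool (bit x (15 - k))" for x k
    by (simp add: qbit_def bit_iff_odd mod_2_eq_odd)
  have dims: "prod_list butterfly_dims = 2 ^ 16" by (simp add: butterfly_dims_def)
  show ?thesis
    unfolding butterfly_init_def tensor_vec_def dims
  proof (rule arg_cong[where f = "vec _"], rule ext)
    fix x :: nat
    \<comment> \<open>The offsets 13, 10, 7, 4, 2 and 0 are the numbers of qubits held by later
      nodes, so each digit is a block of consecutive bits of \<open>x\<close>.\<close>
    define y0 y1 y2 y3 y4 y5 where y: "y0 = x div 2 ^ 13" "y1 = x mod 2 ^ 13 div 2 ^ 10"
      "y2 = x mod 2 ^ 10 div 2 ^ 7" "y3 = x mod 2 ^ 7 div 2 ^ 4" "y4 = x mod 2 ^ 4 div 2 ^ 2"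
      "y5 = x mod 2 ^ 2"
    have digs: "digits butterfly_dims x = [y0, y1, y2, y3, y4, y5]"
      by (simp add: butterfly_dims_def mod_mod_cancel y)
    have bits: "bit y0 k = bit x (13 + k)" "bit y1 k \<longleftrightarrow> 10 + k < 13 \<and> bit x (10 + k)"
      "bit y2 k \<longleftrightarrow> 7 + k < 10 \<and> bit x (7 + k)" "bit y3 k \<longleftrightarrow> 4 + k < 7 \<and> bit x (4 + k)"
      "bit y4 k \<longleftrightarrow> 2 + k < 4 \<and> bit x (2 + k)" "bit y5 k \<longleftrightarrow> k < 2 \<and> bit x k" for k
      unfolding y d md m by (rule refl)+
    define R where "R \<longleftrightarrow> bit x 14 = bit x 3 \<and> bit x 13 = bit x 9 \<and> bit x 11 = bit x 8 \<and>
      bit x 10 = bit x 1 \<and> bit x 7 = bit x 6 \<and> bit x 5 = bit x 2 \<and> bit x 4 = bit x 0"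
    have R: "(\<forall>(a, b)\<in>set epr_positions. qbit x a = qbit x b) \<longleftrightarrow> R"
      unfolding R_def epr_positions_def q by simp
    have amp: "amp_init f (digits butterfly_dims x) =
        (if R then root_half ^ 7 * f (bit x 15) (bit x 12) else 0)" for f
      by (simp add: amp_init_def digs bits R_def)
    show "\<psi> $ (2 * qbit x 0 + qbit x 3) * (if \<forall>(a, b)\<in>set epr_positions. qbit x a = qbit x b
        then (1 / complex_of_real (sqrt 2)) ^ 7 else 0) =
      amp_init (bit_amp \<psi>) (digits butterfly_dims x)"
      unfolding R amp by (simp add: q root_half_def bit_amp_def)
  qed
qed

text \<open>Below, \<open>amp_v\<close> is the global amplitude in a given branch after node \<open>v\<close> has acted. Nodes of dimension
  one have only the digit \<open>0\<close> and drop out of the formulas.\<close>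

definition apply_fst where
  "apply_fst C \<psi> a b = (\<Sum>x\<in>UNIV. C a x * \<psi> x b)" for C \<psi> :: "bool \<Rightarrow> bool \<Rightarrow> complex"

definition apply_snd where
  "apply_snd D \<psi> a b = (\<Sum>x\<in>UNIV. D b x * \<psi> a x)" for D \<psi> :: "bool \<Rightarrow> bool \<Rightarrow> complex"

definition amp_i1 where
  "amp_i1 \<psi> m1 m2 m3 xs = (let a = (bit (xs ! 4) 1 \<noteq> m1) in
    of_bool (a = (bit (xs ! 2) 2 \<noteq> m2)) *
    of_bool (bit (xs ! 1) 1 = bit (xs ! 2) 1) * of_bool (bit (xs ! 1) 0 = bit (xs ! 5) 1) *
    of_bool (bit (xs ! 2) 0 = bit (xs ! 3) 2) * of_bool (bit (xs ! 3) 1 = bit (xs ! 4) 0) *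
    of_bool (bit (xs ! 3) 0 = bit (xs ! 5) 0) *
    (root_half ^ 8 * sgn_bit (a \<and> m3) * \<psi> a (bit (xs ! 1) 2)))" for xs :: "nat list"

definition amp_i2 where
  "amp_i2 \<psi> m1 m2 m3 l1 l2 l3 xs = (let a = (bit (xs ! 4) 1 \<noteq> m1); b = (bit (xs ! 5) 1 \<noteq> l2) in
    of_bool (a = (bit (xs ! 2) 2 \<noteq> m2)) * of_bool (b = (bit (xs ! 2) 1 \<noteq> l1)) *
    of_bool (bit (xs ! 2) 0 = bit (xs ! 3) 2) * of_bool (bit (xs ! 3) 1 = bit (xs ! 4) 0) *
    of_bool (bit (xs ! 3) 0 = bit (xs ! 5) 0) *
    (root_half ^ 9 * sgn_bit (a \<and> m3) * sgn_bit (b \<and> l3) * \<psi> a b))" for xs :: "nat list"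

definition amp_n1 where
  "amp_n1 \<psi> m1 l2 p q m xs = (let a = (bit (xs ! 4) 1 \<noteq> m1); b = (bit (xs ! 5) 1 \<noteq> l2) in
    of_bool (bit (xs ! 3) 2 = ((a \<noteq> b) \<noteq> m)) * of_bool (bit (xs ! 3) 1 = bit (xs ! 4) 0) *
    of_bool (bit (xs ! 3) 0 = bit (xs ! 5) 0) *
    (root_half ^ 9 / 2 * sgn_bit (a \<and> p) * sgn_bit (b \<and> q) * \<psi> a b))" for xs :: "nat list"

text \<open>Digit 4 now holds the X value \<open>u\<close> instead of the Z value \<open>a\<close>,
  so \<open>a\<close> has become a summation variable with the Hadamard kernel. The same happens to
  \<open>b\<close> in \<open>amp_o2\<close>.\<close>

definition amp_o1 where
  "amp_o1 \<psi> l2 q m r xs = (let b = (bit (xs ! 5) 1 \<noteq> l2); u = bit (xs ! 4) 0 in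
    of_bool (bit (xs ! 3) 1 = (u \<noteq> r)) * of_bool (bit (xs ! 3) 0 = bit (xs ! 5) 0) *
    (\<Sum>a\<in>UNIV. of_bool (bit (xs ! 3) 2 = ((a \<noteq> b) \<noteq> m)) *
      (root_half ^ 10 / 2 * sgn_bit (u \<and> a) * sgn_bit (b \<and> q) * \<psi> a b)))" for xs :: "nat list"

definition amp_o2 where
  "amp_o2 \<psi> m r t xs = (let u = bit (xs ! 4) 0; v = bit (xs ! 5) 0 in
    of_bool (bit (xs ! 3) 1 = (u \<noteq> r)) * of_bool (bit (xs ! 3) 0 = (v \<noteq> t)) *
    (\<Sum>a\<in>UNIV. \<Sum>b\<in>UNIV. of_bool (bit (xs ! 3) 2 = ((a \<noteq> b) \<noteq> m)) *
      (root_half ^ 11 / 2 * sgn_bit (u \<and> a) * sgn_bit (v \<and> b) * \<psi> a b)))" for xs :: "nat list"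

definition amp_n2 where
  "amp_n2 \<psi> d w1 w2 w3 xs = (let u = bit (xs ! 4) 0; v = bit (xs ! 5) 0 in
    \<Sum>a\<in>UNIV. \<Sum>b\<in>UNIV. root_half ^ 12 / 4 * sgn_bit (u \<and> a) * sgn_bit (v \<and> b) *
      sgn_bit (w1 \<and> (a \<noteq> b)) * sgn_bit (w2 \<and> u) * sgn_bit (w3 \<and> v) *
      d (a \<noteq> b) (u \<noteq> v) * \<psi> a b)" for xs :: "nat list"

definition amp_final1 where
  "amp_final1 \<psi> d A w1 w2 w3 xs = (let r = bit (xs ! 4) 0; v = bit (xs ! 5) 0 in
    \<Sum>u\<in>UNIV. kraus_final A w1 w2 r u *
    (\<Sum>a\<in>UNIV. \<Sum>b\<in>UNIV. root_half ^ 12 / 4 * sgn_bit (u \<and> a) * sgn_bit (v \<and> b) *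
      sgn_bit (w1 \<and> (a \<noteq> b)) * sgn_bit (w2 \<and> u) * sgn_bit (w3 \<and> v) *
      d (a \<noteq> b) (u \<noteq> v) * \<psi> a b))" for xs :: "nat list"

text \<open>The spectral form: the sum of \<open>d s t\<close> times the projector onto the Bell
  state B_st, proportional to the sum over b of (-1)^(t b) |b+s, b>. The ZZ and XX parities of B_st
  are \<open>s\<close> and \<open>t\<close>.\<close>

definition bell_diag where
  "bell_diag d \<psi> c c' = (\<Sum>t\<in>UNIV. \<Sum>a\<in>UNIV. \<Sum>b\<in>UNIV.
    (if (a \<noteq> b) = (c \<noteq> c') then sgn_bit (t \<and> b) * sgn_bit (t \<and> c') * d (a \<noteq> b) t * \<psi> a b / 2 else 0))"

section \<open>Amplitude identities, one for each protocol step\<close>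

lemma sgn_bit_simps [simp]:
  "sgn_bit False = 1" "sgn_bit True = -1" "sgn_bit x * sgn_bit x = 1" "sgn_bit x * (sgn_bit x * y) = y"
  by (auto simp: sgn_bit_def)

text \<open>All factors that do not involve the digit of the acting node are collected in
  \<open>P\<close>. What remains depends on a handful of bits and can be checked by cases. The steps
  up to \<open>n2\<close> follow this pattern.\<close>

lemma step_i1:
  assumes "length xs = 6"
  shows "(\<Sum>k<8. kraus_in C m1 m2 m3 (bit k 2) (bit k 1) (bit k 0) * amp_init \<psi> (xs[0 := k])) =
    amp_i1 (apply_fst C \<psi>) m1 m2 m3 xs"
proof -
  define P where "P = (of_bool (bit (xs ! 1) 1 = bit (xs ! 2) 1) * of_bool (bit (xs ! 1) 0 = bit (xs ! 5) 1) *
    of_bool (bit (xs ! 2) 0 = bit (xs ! 3) 2) * of_bool (bit (xs ! 3) 1 = bit (xs ! 4) 0) *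
    of_bool (bit (xs ! 3) 0 = bit (xs ! 5) 0) * root_half ^ 7 :: complex)"
  have init: "amp_init \<psi> (xs[0 := k]) = P * (of_bool (bit k 1 = bit (xs ! 4) 1) *
      of_bool (bit k 0 = bit (xs ! 2) 2) * \<psi> (bit k 2) (bit (xs ! 1) 2))" for k
    using assms by (simp add: amp_init_def P_def of_bool_def)
  have i1: "amp_i1 (apply_fst C \<psi>) m1 m2 m3 xs = P * (let a = (bit (xs ! 4) 1 \<noteq> m1) in
      of_bool (a = (bit (xs ! 2) 2 \<noteq> m2)) *
      (root_half * sgn_bit (a \<and> m3) * apply_fst C \<psi> a (bit (xs ! 1) 2)))"
    by (simp add: amp_i1_def P_def Let_def power_numeral_reduce mult_ac)
  show ?thesis
    unfolding init i1 sum_less8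
    by (cases "bit (xs ! 4) 1"; cases "bit (xs ! 2) 2"; cases m1; cases m2)
      (simp_all add: kraus_in_def apply_fst_def UNIV_bool bit_evals algebra_simps)
qed

lemma step_i2:
  assumes "length xs = 6"
  shows "(\<Sum>k<8. kraus_in D l1 l2 l3 (bit k 2) (bit k 1) (bit k 0) *
      amp_i1 \<psi> m1 m2 m3 (xs[1 := k])) =
    amp_i2 (apply_snd D \<psi>) m1 m2 m3 l1 l2 l3 xs"
proof -
  define a where "a = (bit (xs ! 4) 1 \<noteq> m1)"
  define P where "P = (of_bool (a = (bit (xs ! 2) 2 \<noteq> m2)) *
    (of_bool (bit (xs ! 2) 0 = bit (xs ! 3) 2) * of_bool (bit (xs ! 3) 1 = bit (xs ! 4) 0) *
     of_bool (bit (xs ! 3) 0 = bit (xs ! 5) 0)) * (root_half ^ 8 * sgn_bit (a \<and> m3)) :: complex)"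
  have i1: "amp_i1 \<psi> m1 m2 m3 (xs[1 := k]) = P * (of_bool (bit k 1 = bit (xs ! 2) 1) *
      of_bool (bit k 0 = bit (xs ! 5) 1) * \<psi> a (bit k 2))" for k
    using assms by (simp add: amp_i1_def P_def a_def Let_def mult_ac)
  have i2: "amp_i2 (apply_snd D \<psi>) m1 m2 m3 l1 l2 l3 xs = P * (let b = (bit (xs ! 5) 1 \<noteq> l2) in
      of_bool (b = (bit (xs ! 2) 1 \<noteq> l1)) * (root_half * sgn_bit (b \<and> l3) * apply_snd D \<psi> a b))"
    by (simp add: amp_i2_def P_def a_def Let_def power_numeral_reduce mult_ac)
  show ?thesis
    unfolding i1 i2 sum_less8
    by (cases "bit (xs ! 5) 1"; cases "bit (xs ! 2) 1"; cases l1; cases l2)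
      (simp_all add: kraus_in_def apply_snd_def UNIV_bool bit_evals algebra_simps)
qed

lemma step_n1:
  assumes "length xs = 6"
  shows "(\<Sum>k<8. kraus_n1 m2 m3 l1 l3 p q m (bit k 2) (bit k 1) (bit k 0) *
      amp_i2 \<psi> m1 m2 m3 l1 l2 l3 (xs[2 := k])) =
    amp_n1 \<psi> m1 l2 p q m xs"
proof -
  define a b where "a = (bit (xs ! 4) 1 \<noteq> m1)" and "b = (bit (xs ! 5) 1 \<noteq> l2)"
  define P where "P = (of_bool (bit (xs ! 3) 1 = bit (xs ! 4) 0) * of_bool (bit (xs ! 3) 0 = bit (xs ! 5) 0) *
    (root_half ^ 9 * \<psi> a b) :: complex)"
  have i2: "amp_i2 \<psi> m1 m2 m3 l1 l2 l3 (xs[2 := k]) = P * (of_bool (a = (bit k 2 \<noteq> m2)) *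
      of_bool (b = (bit k 1 \<noteq> l1)) * of_bool (bit k 0 = bit (xs ! 3) 2) *
      (sgn_bit (a \<and> m3) * sgn_bit (b \<and> l3)))" for k
    using assms by (simp add: amp_i2_def P_def a_def b_def Let_def mult_ac)
  have n1: "amp_n1 \<psi> m1 l2 p q m xs = P * (of_bool (bit (xs ! 3) 2 = ((a \<noteq> b) \<noteq> m)) *
      (sgn_bit (a \<and> p) * sgn_bit (b \<and> q) / 2))"
    by (simp add: amp_n1_def P_def a_def b_def Let_def)
  show ?thesis
    unfolding i2 n1 sum_less8
    by (cases a; cases b; cases "bit (xs ! 3) 2"; cases m2; cases l1; cases m)
      (simp_all add: kraus_n1_def bit_evals algebra_simps)
qed

lemma step_o1:
  assumes "length xs = 6"
  shows "(\<Sum>k<4. kraus_out m1 p r (bit (xs ! 4) 0) (bit k 1) (bit k 0) *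
      amp_n1 \<psi> m1 l2 p q m (xs[4 := k])) =
    amp_o1 \<psi> l2 q m r xs"
proof -
  define b where "b = (bit (xs ! 5) 1 \<noteq> l2)"
  define P where "P = (of_bool (bit (xs ! 3) 0 = bit (xs ! 5) 0) *
    (root_half ^ 9 / 2 * sgn_bit (b \<and> q)) :: complex)"
  define g where "g a = of_bool (bit (xs ! 3) 2 = ((a \<noteq> b) \<noteq> m)) * \<psi> a b" for a
  have n1: "amp_n1 \<psi> m1 l2 p q m (xs[4 := k]) = P * (of_bool (bit (xs ! 3) 1 = bit k 0) *
      sgn_bit ((bit k 1 \<noteq> m1) \<and> p) * g (bit k 1 \<noteq> m1))" for k
    using assms by (simp add: amp_n1_def P_def b_def g_def Let_def mult_ac)
  have o1: "amp_o1 \<psi> l2 q m r xs = P * (of_bool (bit (xs ! 3) 1 = (bit (xs ! 4) 0 \<noteq> r)) *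
      (\<Sum>a\<in>UNIV. root_half * sgn_bit (bit (xs ! 4) 0 \<and> a) * g a))"
    by (cases "bit (xs ! 5) 1"; cases l2; cases m)
      (simp_all add: amp_o1_def P_def b_def g_def Let_def UNIV_bool power_numeral_reduce algebra_simps)
  show ?thesis
    unfolding n1 o1 sum_less4
    by (cases "bit (xs ! 4) 0"; cases "bit (xs ! 3) 1"; cases r; cases m1; cases p)
      (simp_all add: kraus_out_def bit_evals UNIV_bool algebra_simps)
qed

lemma step_o2:
  assumes "length xs = 6"
  shows "(\<Sum>k<4. kraus_out l2 q t (bit (xs ! 5) 0) (bit k 1) (bit k 0) *
      amp_o1 \<psi> l2 q m r (xs[5 := k])) =
    amp_o2 \<psi> m r t xs"
proof -
  define u where "u = bit (xs ! 4) 0"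
  define P where "P = (of_bool (bit (xs ! 3) 1 = (u \<noteq> r)) * (root_half ^ 10 / 2) :: complex)"
  define g where "g b = (\<Sum>a\<in>UNIV. of_bool (bit (xs ! 3) 2 = ((a \<noteq> b) \<noteq> m)) *
      (sgn_bit (u \<and> a) * \<psi> a b))" for b
  have o1: "amp_o1 \<psi> l2 q m r (xs[5 := k]) = P * (of_bool (bit (xs ! 3) 0 = bit k 0) *
      sgn_bit ((bit k 1 \<noteq> l2) \<and> q) * g (bit k 1 \<noteq> l2))" for k
    using assms
    by (cases "bit k 1"; cases l2; cases m)
      (simp_all add: amp_o1_def P_def u_def g_def Let_def UNIV_bool algebra_simps)
  have o2: "amp_o2 \<psi> m r t xs = P * (of_bool (bit (xs ! 3) 0 = (bit (xs ! 5) 0 \<noteq> t)) *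
      (\<Sum>b\<in>UNIV. root_half * sgn_bit (bit (xs ! 5) 0 \<and> b) * g b))"
    by (simp add: amp_o2_def P_def u_def g_def Let_def UNIV_bool power_numeral_reduce algebra_simps)
  show ?thesis
    unfolding o1 o2 sum_less4
    by (cases "bit (xs ! 5) 0"; cases "bit (xs ! 3) 0"; cases t; cases l2; cases q)
      (simp_all add: kraus_out_def bit_evals UNIV_bool algebra_simps)
qed

lemma step_n2:
  assumes "length xs = 6"
  shows "(\<Sum>k<8. kraus_n2 d m r t w1 w2 w3 (bit k 2) (bit k 1) (bit k 0) *
      amp_o2 \<psi> m r t (xs[3 := k])) =
    amp_n2 \<psi> d w1 w2 w3 xs"
proof -
  define u v where "u = bit (xs ! 4) 0" and "v = bit (xs ! 5) 0"
  define g where "g s = (\<Sum>a\<in>UNIV. \<Sum>b\<in>UNIV. of_bool (s = (a \<noteq> b)) *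
      (sgn_bit (u \<and> a) * sgn_bit (v \<and> b) * \<psi> a b))" for s
  have o2: "amp_o2 \<psi> m r t (xs[3 := k]) = root_half ^ 11 / 2 * (of_bool (bit k 1 = (u \<noteq> r)) *
      of_bool (bit k 0 = (v \<noteq> t)) * g (bit k 2 \<noteq> m))" for k
    using assms
    by (cases m; cases "bit k 2") (simp_all add: amp_o2_def u_def v_def g_def Let_def UNIV_bool algebra_simps)
  have n2: "amp_n2 \<psi> d w1 w2 w3 xs = root_half ^ 12 / 4 *
      (sgn_bit (w2 \<and> u) * sgn_bit (w3 \<and> v) * (\<Sum>s\<in>UNIV. sgn_bit (w1 \<and> s) * d s (u \<noteq> v) * g s))"
    by (simp add: amp_n2_def u_def v_def g_def Let_def UNIV_bool algebra_simps)
  show ?thesis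
    unfolding o2 n2 sum_less8
    by (cases u; cases v; cases m; cases r; cases t)
      (simp_all add: kraus_n2_def bit_evals UNIV_bool power_numeral_reduce algebra_simps)
qed

lemma step_final1:
  assumes "length xs = 6"
  shows "(\<Sum>k<2. kraus_final A w1 w2 (bit (xs ! 4) 0) (bit k 0) *
      amp_n2 \<psi> d w1 w2 w3 (xs[4 := k])) =
    amp_final1 \<psi> d A w1 w2 w3 xs"
  using assms unfolding sum_less2
  by (simp add: amp_n2_def amp_final1_def bit_evals UNIV_bool Let_def)

text \<open>Put v = u + t. The signs with \<open>w2\<close> and \<open>w3\<close> occur twice and
  cancel, and the remaining dependence on \<open>u\<close> is (-1)^(u (a+b+c+c')). Its sum over
  \<open>u\<close> is 2 or 0 and thereby enforces conservation of the ZZ parity, which in turn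
  cancels the four signs with \<open>w1\<close>.\<close>

lemma bell_kernel:
  "(\<Sum>u\<in>UNIV. \<Sum>v\<in>UNIV. sgn_bit (c \<and> u) * sgn_bit (w2 \<and> u) * sgn_bit (w1 \<and> c) *
      (sgn_bit (c' \<and> v) * sgn_bit (w3 \<and> v) * sgn_bit (w1 \<and> c')) *
      (sgn_bit (u \<and> a) * sgn_bit (v \<and> b) * sgn_bit (w1 \<and> (a \<noteq> b)) * sgn_bit (w2 \<and> u) *
       sgn_bit (w3 \<and> v) * d (a \<noteq> b) (u \<noteq> v))) =
    (\<Sum>t\<in>UNIV. if (a \<noteq> b) = (c \<noteq> c') then 2 * (sgn_bit (t \<and> b) * sgn_bit (t \<and> c') * d (a \<noteq> b) t) else 0)"
  by (cases a; cases b; cases c; cases c'; cases w1; cases w2; cases w3)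
    (simp_all add: UNIV_bool sgn_bit_def)

text \<open>The right-hand side contains no outcome: every branch reaches the same vector. The
  factor 1/4 of \<open>amp_n2\<close> is used up by the 2 of \<open>bell_kernel\<close> and the 1/2
  inside \<open>bell_diag\<close>.\<close>

lemma step_final2:
  assumes "length xs = 6"
  shows "(\<Sum>k<2. kraus_final B w1 w3 (bit (xs ! 5) 0) (bit k 0) *
      amp_final1 \<psi> d A w1 w2 w3 (xs[5 := k])) =
    root_half ^ 14 * apply_fst A (apply_snd B (bell_diag d \<psi>)) (bit (xs ! 4) 0) (bit (xs ! 5) 0)"
  (is "?L = _")
proof -
  let ?r = "bit (xs ! 4) 0" and ?r' = "bit (xs ! 5) 0"
  define f where "f c u = sgn_bit (c \<and> u) * sgn_bit (w2 \<and> u) * sgn_bit (w1 \<and> c)" for c u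
  define f' where "f' c v = sgn_bit (c \<and> v) * sgn_bit (w3 \<and> v) * sgn_bit (w1 \<and> c)" for c v
  define g where "g a b u v = sgn_bit (u \<and> a) * sgn_bit (v \<and> b) * sgn_bit (w1 \<and> (a \<noteq> b)) *
    sgn_bit (w2 \<and> u) * sgn_bit (w3 \<and> v) * d (a \<noteq> b) (u \<noteq> v)" for a b u v
  have f: "kraus_final A w1 w2 c u = root_half * (\<Sum>b\<in>UNIV. A c b * f b u)"
    "kraus_final B w1 w3 c u = root_half * (\<Sum>b\<in>UNIV. B c b * f' b u)" for c u
    by (simp_all add: kraus_final_def f_def f'_def mult.assoc)
  have g: "amp_final1 \<psi> d A w1 w2 w3 (xs[5 := k]) =
      (\<Sum>u\<in>UNIV. kraus_final A w1 w2 ?r u *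
        (\<Sum>a\<in>UNIV. \<Sum>b\<in>UNIV. root_half ^ 12 / 4 * (g a b u (bit k 0) * \<psi> a b)))" for k
    using assms by (simp add: amp_final1_def g_def Let_def mult.assoc)
  have "?L = (\<Sum>c\<in>UNIV. \<Sum>c'\<in>UNIV. \<Sum>a\<in>UNIV. \<Sum>b\<in>UNIV.
    root_half ^ 14 / 4 * (A ?r c * B ?r' c' * \<psi> a b) *
    (\<Sum>u\<in>UNIV. \<Sum>v\<in>UNIV. f c u * f' c' v * g a b u v))"
    unfolding sum_less2 f g
    by (simp add: bit_evals UNIV_bool power_numeral_reduce algebra_simps add_divide_distrib)
  also have "\<dots> = (\<Sum>c\<in>UNIV. \<Sum>c'\<in>UNIV. \<Sum>a\<in>UNIV. \<Sum>b\<in>UNIV.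
    root_half ^ 14 / 4 * (A ?r c * B ?r' c' * \<psi> a b) *
    (\<Sum>t\<in>UNIV. if (a \<noteq> b) = (c \<noteq> c') then 2 * (sgn_bit (t \<and> b) * sgn_bit (t \<and> c') * d (a \<noteq> b) t) else 0))"
    unfolding f_def f'_def g_def bell_kernel ..
  also have "\<dots> = root_half ^ 14 * apply_fst A (apply_snd B (bell_diag d \<psi>)) ?r ?r'"
    unfolding apply_fst_def apply_snd_def bell_diag_def
    by (simp add: UNIV_bool algebra_simps)
  finally show ?thesis .
qed

section \<open>Validity and outcome of the protocol\<close>

text \<open>Applied twice in each protocol step with eight outcomes: once to the outcome number,
  giving three classical bits, and once to the basis index of the node, giving its three
  qubits.\<close>

definition bits3 :: "(bool \<Rightarrow> bool \<Rightarrow> bool \<Rightarrow> 'a) \<Rightarrow> nat \<Rightarrow> 'a" where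
  "bits3 g j = g (bit j 2) (bit j 1) (bit j 0)"

text \<open>Both steps have a single outcome and are thus local unitaries. The bit \<open>w1\<close>
  goes to both outputs, \<open>w2\<close> and \<open>w3\<close> to one each.\<close>

definition final_phase where
  "final_phase A B w1 w2 w3 =
    kraus_step 4 1 2 2 (\<lambda>j r k. kraus_final A w1 w2 (bit r 0) (bit k 0)) (\<lambda>j.
    kraus_step 5 1 2 2 (\<lambda>j r k. kraus_final B w1 w3 (bit r 0) (bit k 0)) (\<lambda>j. Done))"

definition n2_phase where
  "n2_phase A B d m r t =
    kraus_step 3 8 1 8 (\<lambda>j _. bits3 (bits3 (kraus_n2 d m r t) j)) (bits3 (final_phase A B))"

definition out_phase where
  "out_phase A B d m1 l2 p q m =
    kraus_step 4 2 2 4 (\<lambda>j r k. kraus_out m1 p (bit j 0) (bit r 0) (bit k 1) (bit k 0)) (\<lambda>i.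
    kraus_step 5 2 2 4 (\<lambda>j r k. kraus_out l2 q (bit j 0) (bit r 0) (bit k 1) (bit k 0)) (\<lambda>j.
    n2_phase A B d m (bit i 0) (bit j 0)))"

definition n1_phase where
  "n1_phase A B d m1 m2 m3 l1 l2 l3 =
    kraus_step 2 8 1 8 (\<lambda>j _. bits3 (bits3 (kraus_n1 m2 m3 l1 l3) j))
      (bits3 (out_phase A B d m1 l2))"

definition i2_phase where
  "i2_phase A B D d m1 m2 m3 =
    kraus_step 1 8 1 8 (\<lambda>j _. bits3 (bits3 (kraus_in D) j)) (bits3 (n1_phase A B d m1 m2 m3))"

definition butterfly_protocol where
  "butterfly_protocol A B C D d =
    kraus_step 0 8 1 8 (\<lambda>j _. bits3 (bits3 (kraus_in C) j)) (bits3 (i2_phase A B D d))"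

lemma bits3_complete:
  fixes k l :: nat
  assumes "\<And>x y z x' y' z'.
      (\<Sum>a\<in>UNIV. \<Sum>b\<in>UNIV. \<Sum>c\<in>UNIV. cnj (g a b c x y z) * g a b c x' y' z') =
      (if x = x' \<and> y = y' \<and> z = z' then 1 else 0)"
    and "k < 8" "l < 8"
  shows "(\<Sum>j<8. \<Sum>r<(1::nat). cnj (bits3 (bits3 g j) k) * bits3 (bits3 g j) l) = (if k = l then 1 else 0)"
proof -
  have "(\<Sum>j<8. \<Sum>r<(1::nat). cnj (bits3 (bits3 g j) k) * bits3 (bits3 g j) l) =
    (\<Sum>j<(8::nat). cnj (bits3 (g (bit j 2) (bit j 1) (bit j 0)) k) * bits3 (g (bit j 2) (bit j 1) (bit j 0)) l)"
    by (simp add: bits3_def)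
  also have "\<dots> = (\<Sum>a\<in>UNIV. \<Sum>b\<in>UNIV. \<Sum>c\<in>UNIV. cnj (bits3 (g a b c) k) * bits3 (g a b c) l)"
    by (rule sum_bits3)
  also have "\<dots> = (if k = l then 1 else 0)"
    unfolding eq_iff_bits3[OF assms(2,3)] bits3_def by (rule assms(1))
  finally show ?thesis .
qed

lemma kraus_out_complete_bits:
  fixes k l :: nat
  assumes "k < 4" "l < 4"
  shows "(\<Sum>j<2. \<Sum>r<2. cnj (kraus_out m p (bit (j::nat) 0) (bit (r::nat) 0) (bit k 1) (bit k 0)) *
      kraus_out m p (bit j 0) (bit r 0) (bit l 1) (bit l 0)) = (if k = l then 1 else 0)"
  unfolding eq_iff_bits2[OF assms] kraus_out_complete[of m p, symmetric]
  unfolding sum_less2 by (simp add: UNIV_bool bit_evals)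

lemma kraus_final_complete_bits:
  fixes k l :: nat
  assumes "unitary_bit A" "k < 2" "l < 2"
  shows "(\<Sum>j<(1::nat). \<Sum>r<2. cnj (kraus_final A w1 w2 (bit (r::nat) 0) (bit k 0)) *
      kraus_final A w1 w2 (bit r 0) (bit l 0)) = (if k = l then 1 else 0)"
  unfolding eq_iff_bits1[OF assms(2,3)] kraus_final_complete[OF assms(1), of w1 w2, symmetric]
  unfolding sum_less2 by (simp add: UNIV_bool bit_evals)

lemma valid_butterfly_protocol:
  assumes "unitary_bit A" "unitary_bit B" "unitary_bit C" "unitary_bit D"
    and "\<And>s t. cnj (d s t) * d s t = 1"
  shows "valid butterfly_dims (butterfly_protocol A B C D d) output_dims"
proof -
  have final: "valid [1, 1, 1, 1, 2, 2] (final_phase A B w1 w2 w3) output_dims" for w1 w2 w3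
    unfolding final_phase_def
    by (intro valid_kraus_step kraus_final_complete_bits assms)
      (simp_all add: output_dims_def valid_Done)
  have n2: "valid [1, 1, 1, 8, 2, 2] (n2_phase A B d m r t) output_dims" for m r t
    unfolding n2_phase_def
    by (rule valid_kraus_step, simp, simp, simp, rule bits3_complete[OF kraus_n2_complete[OF assms(5)]])
      (simp_all add: bits3_def final[simplified])
  have out: "valid [1, 1, 1, 8, 4, 4] (out_phase A B d m1 l2 p q m) output_dims" for m1 l2 p q m
    unfolding out_phase_def
    by (intro valid_kraus_step kraus_out_complete_bits) (simp_all add: n2[simplified])
  have n1: "valid [1, 1, 8, 8, 4, 4] (n1_phase A B d m1 m2 m3 l1 l2 l3) output_dims" for m1 m2 m3 l1 l2 l3
    unfolding n1_phase_def
    by (rule valid_kraus_step, simp, simp, simp, rule bits3_complete[OF kraus_n1_complete])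
      (simp_all add: bits3_def out[simplified])
  have i2: "valid [1, 8, 8, 8, 4, 4] (i2_phase A B D d m1 m2 m3) output_dims" for m1 m2 m3
    unfolding i2_phase_def
    by (rule valid_kraus_step, simp, simp, simp, rule bits3_complete[OF kraus_in_complete[OF assms(4)]])
      (simp_all add: bits3_def n1[simplified])
  show ?thesis
    unfolding butterfly_protocol_def butterfly_dims_def
    by (rule valid_kraus_step, simp, simp, simp, rule bits3_complete[OF kraus_in_complete[OF assms(3)]])
      (simp_all add: bits3_def i2[simplified])
qed

lemma run_kraus_step6:
  assumes "v < length ds" "ds ! v = d" "length ds = 6"
    and T: "T \<in> carrier_mat (prod_list ds') (prod_list ds')"
    and branch: "\<And>j xs. length xs = 6 \<Longrightarrow> (\<Sum>k<d. f j (xs ! v) k * F (xs[v := k])) = G j xs"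
    and rest: "\<And>j. run ds' (ds[v := e]) (Q j) (proj (tensor_vec (ds[v := e]) (G j))) = c \<cdot>\<^sub>m T"
    and "c' = of_nat n * c"
  shows "run ds' ds (kraus_step v n e d f Q) (proj (tensor_vec ds F)) = c' \<cdot>\<^sub>m T"
  unfolding \<open>c' = _\<close>
  by (rule run_kraus_step[OF assms(1,2) T _ rest])
    (auto intro!: tensor_vec_cong branch dest: list_all2_lengthD simp: assms(3))

text \<open>The exponent counts measured bits: three at each of \<open>i1\<close>,
  \<open>i2\<close>, \<open>n1\<close>, \<open>n2\<close> and one at each output node. The phases
  are treated from last to first because a step needs the common result of its
  continuations.\<close>

lemma run_butterfly_protocol:
  fixes A B C D d \<psi>
  defines "T \<equiv> proj (tensor_vec output_dims (\<lambda>xs. root_half ^ 14 *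
      apply_fst A (apply_snd B (bell_diag d (apply_snd D (apply_fst C \<psi>)))) (bit (xs ! 4) 0) (bit (xs ! 5) 0)))"
  shows "run output_dims butterfly_dims (butterfly_protocol A B C D d)
    (proj (tensor_vec butterfly_dims (amp_init \<psi>))) = 2 ^ 14 \<cdot>\<^sub>m T"
proof -
  have T: "T \<in> carrier_mat (prod_list output_dims) (prod_list output_dims)"
    by (simp add: T_def proj_def)
  have one: "1 \<cdot>\<^sub>m M = M" for M :: "complex mat"
    by auto
  let ?\<phi> = "apply_snd D (apply_fst C \<psi>)"
  have final2: "run output_dims [1, 1, 1, 1, 2, 2]
      (kraus_step 5 1 2 2 (\<lambda>j r k. kraus_final B w1 w3 (bit r 0) (bit k 0)) (\<lambda>j. Done))
      (proj (tensor_vec [1, 1, 1, 1, 2, 2] (amp_final1 ?\<phi> d A w1 w2 w3))) = 1 \<cdot>\<^sub>m T" for w1 w2 w3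
    by (rule run_kraus_step6[OF _ _ _ T step_final2, where c = 1])
      (simp_all add: one T_def output_dims_def)
  have final: "run output_dims [1, 1, 1, 1, 2, 2] (final_phase A B w1 w2 w3)
      (proj (tensor_vec [1, 1, 1, 1, 2, 2] (amp_n2 ?\<phi> d w1 w2 w3))) = 1 \<cdot>\<^sub>m T" for w1 w2 w3
    unfolding final_phase_def
    by (rule run_kraus_step6[OF _ _ _ T step_final1, where c = 1])
      (simp_all add: final2[simplified] one)
  have n2: "run output_dims [1, 1, 1, 8, 2, 2] (n2_phase A B d m r t)
      (proj (tensor_vec [1, 1, 1, 8, 2, 2] (amp_o2 ?\<phi> m r t))) = 2 ^ 3 \<cdot>\<^sub>m T" for m r t
    unfolding n2_phase_def
    by (rule run_kraus_step6[OF _ _ _ T, where c = 1 and G = "bits3 (amp_n2 ?\<phi> d)"])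
      (simp_all add: bits3_def step_n2[simplified] final[simplified] one)
  have o2: "run output_dims [1, 1, 1, 8, 2, 4]
      (kraus_step 5 2 2 4 (\<lambda>j r k. kraus_out l2 q (bit j 0) (bit r 0) (bit k 1) (bit k 0)) (\<lambda>j.
        n2_phase A B d m r (bit j 0)))
      (proj (tensor_vec [1, 1, 1, 8, 2, 4] (amp_o1 ?\<phi> l2 q m r))) = 2 ^ 4 \<cdot>\<^sub>m T" for l2 q m r
    by (rule run_kraus_step6[OF _ _ _ T, where c = "2 ^ 3" and G = "\<lambda>j. amp_o2 ?\<phi> m r (bit j 0)"])
      (simp_all add: step_o2[simplified] n2[simplified])
  have out: "run output_dims [1, 1, 1, 8, 4, 4] (out_phase A B d m1 l2 p q m)
      (proj (tensor_vec [1, 1, 1, 8, 4, 4] (amp_n1 ?\<phi> m1 l2 p q m))) = 2 ^ 5 \<cdot>\<^sub>m T" for m1 l2 p q m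
    unfolding out_phase_def
    by (rule run_kraus_step6[OF _ _ _ T, where c = "2 ^ 4" and G = "\<lambda>j. amp_o1 ?\<phi> l2 q m (bit j 0)"])
      (simp_all add: step_o1[simplified] o2[simplified])
  have n1: "run output_dims [1, 1, 8, 8, 4, 4] (n1_phase A B d m1 m2 m3 l1 l2 l3)
      (proj (tensor_vec [1, 1, 8, 8, 4, 4] (amp_i2 ?\<phi> m1 m2 m3 l1 l2 l3))) = 2 ^ 8 \<cdot>\<^sub>m T"
    for m1 m2 m3 l1 l2 l3
    unfolding n1_phase_def
    by (rule run_kraus_step6[OF _ _ _ T, where c = "2 ^ 5" and G = "bits3 (amp_n1 ?\<phi> m1 l2)"])
      (simp_all add: bits3_def step_n1[simplified] out[simplified])
  have i2: "run output_dims [1, 8, 8, 8, 4, 4] (i2_phase A B D d m1 m2 m3)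
      (proj (tensor_vec [1, 8, 8, 8, 4, 4] (amp_i1 (apply_fst C \<psi>) m1 m2 m3))) = 2 ^ 11 \<cdot>\<^sub>m T"
    for m1 m2 m3
    unfolding i2_phase_def
    by (rule run_kraus_step6[OF _ _ _ T, where c = "2 ^ 8" and G = "bits3 (amp_i2 ?\<phi> m1 m2 m3)"])
      (simp_all add: bits3_def step_i2[simplified] n1[simplified])
  show ?thesis
    unfolding butterfly_protocol_def butterfly_dims_def
    by (rule run_kraus_step6[OF _ _ _ T, where c = "2 ^ 11" and G = "bits3 (amp_i1 (apply_fst C \<psi>))"])
      (simp_all add: bits3_def step_i1[simplified] i2[simplified])
qed

section \<open>Real eigenvectors of symmetric unitary matrices\<close>

lemma adj_carrier [simp]: "A \<in> carrier_mat n m \<Longrightarrow> adj A \<in> carrier_mat m n"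
  by (auto simp: adj_def)

lemma adj_adj [simp]: "adj (adj A) = A"
  by (rule eq_matI) (auto simp: adj_def)

lemma adj_mult:
  assumes "A \<in> carrier_mat n m" "B \<in> carrier_mat m k"
  shows "adj (A * B) = adj B * adj A"
proof (rule eq_matI)
  fix i j assume "i < dim_row (adj B * adj A)" "j < dim_col (adj B * adj A)"
  then show "adj (A * B) $$ (i, j) = (adj B * adj A) $$ (i, j)"
    using assms by (auto simp: adj_def scalar_prod_def cnj_sum mult.commute intro!: sum.cong)
qed (use assms in \<open>auto simp: adj_def\<close>)

text \<open>For a symmetric unitary matrix the entrywise conjugate is the inverse. Hence the
  conjugate of an eigenvector has the same eigenvalue, and so do the real and imaginary parts; one
  of them is nonzero and can be normalised. The last conclusion keeps zeros of \<open>x\<close>,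
  which the deflation below relies on.\<close>

lemma symmetric_unitary_real_eigenvector:
  fixes S :: "complex mat"
  assumes S: "S \<in> carrier_mat n n" "transpose_mat S = S" "adj S * S = 1\<^sub>m n"
    and x: "x \<in> carrier_vec n" "x \<noteq> 0\<^sub>v n" "S *\<^sub>v x = \<mu> \<cdot>\<^sub>v x"
  obtains w :: "nat \<Rightarrow> real" where "(\<Sum>i<n. (w i)\<^sup>2) = 1"
    "S *\<^sub>v vec n (\<lambda>i. of_real (w i)) = \<mu> \<cdot>\<^sub>v vec n (\<lambda>i. of_real (w i))"
    "\<And>i. i < n \<Longrightarrow> x $ i = 0 \<Longrightarrow> w i = 0"
proof -
  define s where "s i j = S $$ (i, j)" for i j
  have sym: "s i j = s j i" if "i < n" "j < n" for i j
    using that S(1,2) unfolding s_def by (metis index_transpose_mat(1) carrier_matD)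
  have unit: "(\<Sum>j<n. cnj (s i j) * s j k) = (if i = k then 1 else 0)" if "i < n" "k < n" for i k
  proof -
    have "(\<Sum>j<n. cnj (s i j) * s j k) = (\<Sum>j<n. cnj (s j i) * s j k)"
      using that by (intro sum.cong) (auto simp: sym[of i])
    also have "\<dots> = (adj S * S) $$ (i, k)"
      using S(1) that by (simp add: adj_def scalar_prod_def s_def atLeast0LessThan)
    finally show ?thesis using that S(3) by simp
  qed
  have eig: "(\<Sum>j<n. s i j * x $ j) = \<mu> * x $ i" if "i < n" for i
  proof -
    have "(S *\<^sub>v x) $ i = (\<Sum>j<n. s i j * x $ j)"
      using S(1) x(1) that by (auto simp: scalar_prod_def s_def atLeast0LessThan)
    then show ?thesis using x that by simp
  qed
  \<comment> \<open>The entrywise conjugate of \<open>S\<close> applied to \<open>x\<close>, that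
    is, the inverse of \<open>S\<close> applied to \<open>x\<close>.\<close>
  define y where "y i = (\<Sum>j<n. cnj (s i j) * x $ j)" for i
  have y: "\<mu> * y i = x $ i" if "i < n" for i
  proof -
    have "\<mu> * y i = (\<Sum>j<n. cnj (s i j) * (\<mu> * x $ j))"
      by (simp add: y_def sum_distrib_left mult_ac)
    also have "\<dots> = (\<Sum>j<n. cnj (s i j) * (\<Sum>k<n. s j k * x $ k))"
      by (simp add: eig)
    also have "\<dots> = (\<Sum>k<n. (\<Sum>j<n. cnj (s i j) * s j k) * x $ k)"
      unfolding sum_distrib_left sum_distrib_right by (subst sum.swap) (simp add: mult.assoc)
    also have "\<dots> = (\<Sum>k<n. (if i = k then 1 else 0) * x $ k)"
      using that by (intro sum.cong) (auto simp: unit)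
    also have "\<dots> = x $ i"
      using that by (simp add: if_distrib[where f = "\<lambda>c. c * _"] cong: if_cong)
    finally show ?thesis .
  qed
  define N where "N = (\<Sum>i<n. (cmod (x $ i))\<^sup>2)"
  have N: "of_real N = (\<Sum>i<n. cnj (x $ i) * x $ i)"
    unfolding N_def of_real_sum complex_norm_square by (simp add: mult.commute)
  have "N \<noteq> 0"
  proof
    assume "N = 0"
    then have "\<forall>i<n. x $ i = 0" by (simp add: N_def sum_nonneg_eq_0_iff)
    then show False using x(1,2) by (auto intro: eq_vecI)
  qed
  \<comment> \<open>Moving the conjugate of \<open>S\<close> to the other side of the inner product
    gives N = \<open>\<mu> * cnj \<mu>\<close> N, hence \<open>\<mu>\<close> has modulus
    one.\<close>
  have "of_real N = (\<Sum>i<n. cnj (x $ i) * (\<mu> * y i))"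
    by (simp add: N y)
  also have "\<dots> = \<mu> * (\<Sum>i<n. \<Sum>j<n. cnj (x $ i) * (cnj (s i j) * x $ j))"
    by (simp add: y_def sum_distrib_left mult_ac)
  also have "\<dots> = \<mu> * (\<Sum>j<n. x $ j * cnj (\<Sum>i<n. s j i * x $ i))"
    by (subst sum.swap) (auto simp: cnj_sum sum_distrib_left mult_ac sym intro!: sum.cong arg_cong[where f = "(*) \<mu>"])
  also have "\<dots> = \<mu> * (\<Sum>j<n. x $ j * cnj (\<mu> * x $ j))"
    by (intro arg_cong[where f = "(*) \<mu>"] sum.cong) (simp_all only: eig lessThan_iff)
  also have "\<dots> = \<mu> * cnj \<mu> * of_real N"
    by (simp add: N sum_distrib_left mult_ac)
  finally have norm: "\<mu> * cnj \<mu> = 1"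
    using \<open>N \<noteq> 0\<close> by simp
  have eig_cnj: "(\<Sum>j<n. s i j * cnj (x $ j)) = \<mu> * cnj (x $ i)" if "i < n" for i
  proof -
    have "cnj (y i) = (\<Sum>j<n. s i j * cnj (x $ j))" by (simp add: y_def cnj_sum)
    moreover have "cnj (x $ i) = cnj \<mu> * cnj (y i)" using y[OF that] by (metis complex_cnj_mult)
    ultimately show ?thesis using norm by (metis mult.assoc mult.left_neutral)
  qed
  note obtain_w = that
  have finish: thesis if u: "u = (\<lambda>i. Re (x $ i)) \<or> u = (\<lambda>i. Im (x $ i))" and "i < n" "u i \<noteq> 0" for u i
  proof -
    have eigu: "(\<Sum>j<n. s i j * of_real (u j)) = \<mu> * of_real (u i)" if "i < n" for i
    proof (cases "u = (\<lambda>i. Re (x $ i))")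
      case True
      then have re: "of_real (u j) = (x $ j + cnj (x $ j)) / 2" for j
        by (simp add: complex_add_cnj)
      show ?thesis using eig[OF that] eig_cnj[OF that]
        unfolding re times_divide_eq_right sum_divide_distrib[symmetric] distrib_left sum.distrib by simp
    next
      case False
      then have im: "of_real (u j) = (x $ j - cnj (x $ j)) / (2 * \<i>)" for j
        using u by (auto simp: complex_diff_cnj mult.commute[of _ \<i>])
      show ?thesis using eig[OF that] eig_cnj[OF that]
        unfolding im times_divide_eq_right sum_divide_distrib[symmetric] right_diff_distrib sum_subtractf by simp
    qed
    define M where "M = (\<Sum>i<n. (u i)\<^sup>2)"
    have "0 < M"
      unfolding M_def using that(2,3) by (intro sum_pos2[where i = i]) auto
    define w where "w i = u i / sqrt M" for i
    show thesis
    proof (rule obtain_w[of w])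
      show "(\<Sum>i<n. (w i)\<^sup>2) = 1"
        using \<open>0 < M\<close> by (simp add: w_def power_divide sum_divide_distrib[symmetric] M_def)
      have "(\<Sum>j<n. s i j * of_real (w j)) = \<mu> * of_real (w i)" if "i < n" for i
        using eigu[OF that] by (simp add: w_def sum_divide_distrib[symmetric])
      then show "S *\<^sub>v vec n (\<lambda>i. of_real (w i)) = \<mu> \<cdot>\<^sub>v vec n (\<lambda>i. of_real (w i))"
        using S(1) by (intro eq_vecI) (auto simp: scalar_prod_def s_def atLeast0LessThan)
      show "w i = 0" if "i < n" "x $ i = 0" for i
        using that u by (auto simp: w_def)
    qed
  qed
  from \<open>x \<noteq> 0\<^sub>v n\<close> x(1) obtain i where "i < n" "x $ i \<noteq> 0"
    by (metis carrier_vecD eq_vecI index_zero_vec)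
  then show thesis
    using finish[of "\<lambda>i. Re (x $ i)" i] finish[of "\<lambda>i. Im (x $ i)" i]
    by (auto simp: complex_eq_iff)
qed

text \<open>By symmetry, unit eigenvectors clear rows as well as columns, so \<open>S\<close> splits
  into blocks. An eigenvector of the lower block \<open>M\<close> exists since the spectrum is
  nonempty; padded with zeros it is one of \<open>S\<close>, and passing to a real vector preserves
  the zeros.\<close>

lemma symmetric_unitary_block_real_eigenvector:
  fixes S :: "complex mat"
  assumes S: "S \<in> carrier_mat n n" "transpose_mat S = S" "adj S * S = 1\<^sub>m n" and "k < n"
    and block: "\<And>i. i < k \<Longrightarrow> \<exists>c. S *\<^sub>v unit_vec n i = c \<cdot>\<^sub>v unit_vec n i"
  obtains w :: "nat \<Rightarrow> real" and \<mu> where "(\<Sum>i<n. (w i)\<^sup>2) = 1"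
    "S *\<^sub>v vec n (\<lambda>i. of_real (w i)) = \<mu> \<cdot>\<^sub>v vec n (\<lambda>i. of_real (w i))"
    "\<And>i. i < k \<Longrightarrow> w i = 0"
proof -
  have zero: "S $$ (i, j) = 0" if "i < k" "j < n" "i \<noteq> j" for i j
  proof -
    obtain c where c: "S *\<^sub>v unit_vec n i = c \<cdot>\<^sub>v unit_vec n i" using block \<open>i < k\<close> by blast
    have "S $$ (i, j) = S $$ (j, i)"
      using S(1,2) that \<open>k < n\<close> by (metis index_transpose_mat(1) carrier_matD less_trans)
    also have "\<dots> = (S *\<^sub>v unit_vec n i) $ j"
      using S(1) that \<open>k < n\<close> by (simp add: scalar_prod_right_unit)
    finally show ?thesis using c that \<open>k < n\<close> by simp
  qed
  define M where "M = mat (n - k) (n - k) (\<lambda>(i, j). S $$ (i + k, j + k))"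
  have M: "M \<in> carrier_mat (n - k) (n - k)" by (simp add: M_def)
  obtain \<mu> where "\<mu> \<in> spectrum M"
    using spectrum_non_empty[OF M] \<open>k < n\<close> by auto
  then obtain v where v: "v \<in> carrier_vec (n - k)" "v \<noteq> 0\<^sub>v (n - k)" "M *\<^sub>v v = \<mu> \<cdot>\<^sub>v v"
    using M by (auto simp: spectrum_def eigenvalue_def eigenvector_def)
  define x where "x = vec n (\<lambda>i. if i < k then 0 else v $ (i - k))"
  have split: "(\<Sum>j<n. g j) = (\<Sum>j<k. g j) + (\<Sum>j<n-k. g (j + k))" for g :: "nat \<Rightarrow> complex"
  proof -
    have "(\<Sum>j<n. g j) = (\<Sum>j<k. g j) + (\<Sum>j=k..<n. g j)"
      using \<open>k < n\<close> sum.atLeastLessThan_concat[of 0 k n g] by (simp add: atLeast0LessThan)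
    also have "(\<Sum>j=k..<n. g j) = (\<Sum>j<n-k. g (j + k))"
      by (subst sum.atLeastLessThan_shift_0) (simp add: atLeast0LessThan add.commute)
    finally show ?thesis .
  qed
  have Sx: "S *\<^sub>v x = \<mu> \<cdot>\<^sub>v x"
  proof (rule eq_vecI)
    fix i assume "i < dim_vec (\<mu> \<cdot>\<^sub>v x)"
    then have i: "i < n" by (simp add: x_def)
    have e: "(S *\<^sub>v x) $ i = (\<Sum>j<n. S $$ (i, j) * x $ j)"
      using S(1) i by (simp add: x_def scalar_prod_def atLeast0LessThan)
    show "(S *\<^sub>v x) $ i = (\<mu> \<cdot>\<^sub>v x) $ i"
    proof (cases "i < k")
      case True
      then have "(\<Sum>j<n. S $$ (i, j) * x $ j) = 0"
        by (intro sum.neutral) (auto simp: x_def zero)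
      then show ?thesis using True i e by (simp add: x_def)
    next
      case False
      have "(\<Sum>j<n. S $$ (i, j) * x $ j) = (\<Sum>j<n-k. S $$ (i, j + k) * v $ j)"
        unfolding split using \<open>k < n\<close> by (auto simp: x_def intro!: sum.cong)
      also have "\<dots> = (M *\<^sub>v v) $ (i - k)"
        using False i v(1) by (auto simp: M_def scalar_prod_def atLeast0LessThan)
      also have "\<dots> = \<mu> * v $ (i - k)" using False i v by simp
      finally show ?thesis using False i e by (simp add: x_def)
    qed
  qed (use S(1) in \<open>simp add: x_def\<close>)
  have "x \<noteq> 0\<^sub>v n"
  proof
    assume "x = 0\<^sub>v n"
    then have "x $ (i + k) = 0" if "i < n - k" for i
      using that by simp
    then have "v $ i = 0" if "i < n - k" for i
      using that by (simp add: x_def)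
    then show False using v(1,2) by (auto intro: eq_vecI)
  qed
  moreover have "x \<in> carrier_vec n" by (simp add: x_def)
  ultimately obtain w where "(\<Sum>i<n. (w i)\<^sup>2) = 1"
    "S *\<^sub>v vec n (\<lambda>i. of_real (w i)) = \<mu> \<cdot>\<^sub>v vec n (\<lambda>i. of_real (w i))"
    "\<And>i. i < n \<Longrightarrow> x $ i = 0 \<Longrightarrow> w i = 0"
    using symmetric_unitary_real_eigenvector[OF S _ _ Sx] by metis
  then show thesis using that \<open>k < n\<close> by (auto simp: x_def)
qed

section \<open>Local rotations in the magic basis\<close>

lemma less4_cases: "i < 4 \<Longrightarrow> i = 0 \<or> i = 1 \<or> i = 2 \<or> i = (3::nat)"
  by auto

definition kron_bit :: "(bool \<Rightarrow> bool \<Rightarrow> complex) \<Rightarrow> (bool \<Rightarrow> bool \<Rightarrow> complex) \<Rightarrow> complex mat" where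
  "kron_bit A B = mat 4 4 (\<lambda>(i, j). A (bit i 1) (bit j 1) * B (bit i 0) (bit j 0))"

definition comp_bit :: "(bool \<Rightarrow> bool \<Rightarrow> complex) \<Rightarrow> (bool \<Rightarrow> bool \<Rightarrow> complex) \<Rightarrow> bool \<Rightarrow> bool \<Rightarrow> complex" where
  "comp_bit A B r a = (\<Sum>c\<in>UNIV. A r c * B c a)"

definition magic :: "complex mat" where
  "magic = mat 4 4 (\<lambda>(i, j). root_half *
    ([[1, 0, 0, \<i>], [0, \<i>, 1, 0], [0, \<i>, -1, 0], [1, 0, 0, -\<i>]] ! i ! j))"

text \<open>The columns of \<open>magic\<close> are the normalised coefficient matrices \<open>1\<close>, \<open>\<i>X\<close>, \<open>\<i>Y\<close>, \<open>\<i>Z\<close> of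
  two-qubit states, that is, the unit quaternions. A local unitary acts by \<open>q \<mapsto> A q B\<^sup>T\<close>; the Givens
  rotation in the first two coordinates arises as \<open>q \<mapsto> p q p\<close>, the other two as conjugations.\<close>

definition givens :: "nat \<Rightarrow> real \<Rightarrow> complex mat" where
  "givens k t = mat 4 4 (\<lambda>(i, j).
    if j = k then (if i = k then of_real (cos t) else if i = Suc k then of_real (sin t) else 0)
    else if j = Suc k then (if i = k then - of_real (sin t) else if i = Suc k then of_real (cos t) else 0)
    else if i = j then 1 else 0)"

lemma kron_bit_carrier [simp]: "kron_bit A B \<in> carrier_mat 4 4"
  and magic_carrier [simp]: "magic \<in> carrier_mat 4 4"
  and givens_carrier [simp]: "givens k t \<in> carrier_mat 4 4"
  by (simp_all add: kron_bit_def magic_def givens_def)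

lemma mult_mat4_index:
  assumes "A \<in> carrier_mat 4 4" "B \<in> carrier_mat 4 4" "i < 4" "j < 4"
  shows "(A * B) $$ (i, j) = A $$ (i, 0) * B $$ (0, j) + A $$ (i, 1) * B $$ (1, j) +
    A $$ (i, 2) * B $$ (2, j) + A $$ (i, 3) * (B $$ (3, j) :: complex)"
  using assms by (simp add: scalar_prod_def atLeast0LessThan sum_less4)

lemma eq_mat4I:
  assumes "A \<in> carrier_mat 4 4" "B \<in> carrier_mat 4 4"
    and "\<And>i j. i < 4 \<Longrightarrow> j < 4 \<Longrightarrow> A $$ (i, j) = B $$ (i, j)"
  shows "A = B"
  using assms by (intro eq_matI) auto

lemma comp_unitary_bit:
  assumes "unitary_bit A" "unitary_bit B"
  shows "unitary_bit (comp_bit A B)"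
  unfolding unitary_bit_def
proof (intro allI)
  fix a b
  have "(\<Sum>r\<in>UNIV. cnj (comp_bit A B r a) * comp_bit A B r b) =
    (\<Sum>c\<in>UNIV. \<Sum>c'\<in>UNIV. cnj (B c a) * B c' b * (\<Sum>r\<in>UNIV. cnj (A r c) * A r c'))"
    by (simp add: comp_bit_def UNIV_bool algebra_simps)
  also have "\<dots> = (\<Sum>c\<in>UNIV. cnj (B c a) * B c b)"
    using assms(1) unfolding unitary_bit_def by (simp add: UNIV_bool)
  also have "\<dots> = (if a = b then 1 else 0)"
    using assms(2) unfolding unitary_bit_def by blast
  finally show "(\<Sum>r\<in>UNIV. cnj (comp_bit A B r a) * comp_bit A B r b) = (if a = b then 1 else 0)" .
qed

lemma kron_bit_mult: "kron_bit A B * kron_bit A' B' = kron_bit (comp_bit A A') (comp_bit B B')"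
proof (rule eq_mat4I)
  fix i j :: nat assume "i < 4" "j < 4"
  then show "(kron_bit A B * kron_bit A' B') $$ (i, j) = kron_bit (comp_bit A A') (comp_bit B B') $$ (i, j)"
    by (simp add: mult_mat4_index)
      (simp add: kron_bit_def comp_bit_def UNIV_bool bit_evals algebra_simps)
qed (simp_all add: mult_carrier_mat[of _ 4 4 _ 4])

definition local_in_magic :: "complex mat \<Rightarrow> bool" where
  "local_in_magic R \<longleftrightarrow>
    (\<exists>A B. unitary_bit A \<and> unitary_bit B \<and> kron_bit A B * magic = magic * R)"

lemma local_in_magic_mult:
  assumes "R \<in> carrier_mat 4 4" "R' \<in> carrier_mat 4 4" "local_in_magic R" "local_in_magic R'"
  shows "local_in_magic (R * R')"
proof -
  obtain A B A' B' where *: "unitary_bit A" "unitary_bit B" "kron_bit A B * magic = magic * R"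
    "unitary_bit A'" "unitary_bit B'" "kron_bit A' B' * magic = magic * R'"
    using assms(3,4) unfolding local_in_magic_def by blast
  have "kron_bit (comp_bit A A') (comp_bit B B') * magic = kron_bit A B * (kron_bit A' B' * magic)"
    unfolding kron_bit_mult[symmetric] by (rule assoc_mult_mat[of _ 4 4 _ 4 _ 4]) auto
  also have "\<dots> = (kron_bit A B * magic) * R'"
    unfolding *(6) using assms(2) by (intro assoc_mult_mat[of _ 4 4 _ 4 _ 4, symmetric]) auto
  also have "\<dots> = magic * (R * R')"
    unfolding *(3) using assms(1,2) by (intro assoc_mult_mat[of _ 4 4 _ 4 _ 4]) auto
  finally show ?thesis
    unfolding local_in_magic_def using comp_unitary_bit * by blast
qed

text \<open>The unitary exp(i t Z), with \<open>False\<close> standing for |0>;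
  \<open>phase_x\<close> is exp(i t X).\<close>

definition phase_z :: "real \<Rightarrow> bool \<Rightarrow> bool \<Rightarrow> complex" where
  "phase_z t r a = (if r = a then Complex (cos t) (if a then - sin t else sin t) else 0)"

definition phase_x :: "real \<Rightarrow> bool \<Rightarrow> bool \<Rightarrow> complex" where
  "phase_x t r a = (if r = a then of_real (cos t) else \<i> * of_real (sin t))"

lemma cos_sin_sq:
  fixes x t :: real
  shows "cos t * cos t + sin t * sin t = 1" "sin t * sin t + cos t * cos t = 1"
    "x * (cos t * cos t) + x * (sin t * sin t) = x" "x * (sin t * sin t) + x * (cos t * cos t) = x"
  using sin_cos_squared_add3[of t] by (simp_all add: add.commute flip: distrib_left)

lemma unitary_phase_z: "unitary_bit (phase_z t)"
  by (simp add: unitary_bit_def phase_z_def UNIV_bool complex_eq_iff all_bool_eq cos_sin_sq)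

lemma unitary_phase_x: "unitary_bit (phase_x t)"
  by (simp add: unitary_bit_def phase_x_def UNIV_bool complex_eq_iff all_bool_eq cos_sin_sq)

text \<open>For p = exp(i t X) the map q to p q p doubles the angle on 1 and iX, which commute with
  p, and is trivial on iY and iZ, which anticommute with iX. The hypotheses spell out u =
  2t.\<close>

lemma kron_phase_x_magic:
  assumes "cos u = cos t * cos t - sin t * sin t" "sin u = 2 * (sin t * cos t)"
  shows "kron_bit (phase_x t) (phase_x t) * magic = magic * givens 0 u"
proof (rule eq_mat4I)
  fix i j :: nat assume ij: "i < 4" "j < 4"
  show "(kron_bit (phase_x t) (phase_x t) * magic) $$ (i, j) = (magic * givens 0 u) $$ (i, j)"
    unfolding mult_mat4_index[OF kron_bit_carrier magic_carrier ij]
      mult_mat4_index[OF magic_carrier givens_carrier ij]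
    using less4_cases[OF ij(1)] less4_cases[OF ij(2)]
    by (elim disjE)
      (simp_all add: kron_bit_def magic_def givens_def phase_x_def bit_evals complex_eq_iff
        assms cos_sin_sq algebra_simps)
qed (simp_all add: mult_carrier_mat[of _ 4 4 _ 4])

text \<open>Conjugation by exp(i t Z) fixes 1 and iZ and turns the plane of iX and iY by 2t; in the
  next lemma X takes the role of Z and the plane is that of iY and iZ.\<close>

lemma kron_phase_z_magic:
  assumes "cos u = cos t * cos t - sin t * sin t" "sin u = 2 * (sin t * cos t)"
  shows "kron_bit (phase_z (- t)) (phase_z t) * magic = magic * givens 1 u"
proof (rule eq_mat4I)
  fix i j :: nat assume ij: "i < 4" "j < 4"
  show "(kron_bit (phase_z (- t)) (phase_z t) * magic) $$ (i, j) = (magic * givens 1 u) $$ (i, j)"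
    unfolding mult_mat4_index[OF kron_bit_carrier magic_carrier ij]
      mult_mat4_index[OF magic_carrier givens_carrier ij]
    using less4_cases[OF ij(1)] less4_cases[OF ij(2)]
    by (elim disjE)
      (simp_all add: kron_bit_def magic_def givens_def phase_z_def bit_evals complex_eq_iff
        assms cos_sin_sq algebra_simps)
qed (simp_all add: mult_carrier_mat[of _ 4 4 _ 4])

lemma kron_phase_x_conj_magic:
  assumes "cos u = cos t * cos t - sin t * sin t" "sin u = 2 * (sin t * cos t)"
  shows "kron_bit (phase_x (- t)) (phase_x t) * magic = magic * givens 2 u"
proof (rule eq_mat4I)
  fix i j :: nat assume ij: "i < 4" "j < 4"
  show "(kron_bit (phase_x (- t)) (phase_x t) * magic) $$ (i, j) = (magic * givens 2 u) $$ (i, j)"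
    unfolding mult_mat4_index[OF kron_bit_carrier magic_carrier ij]
      mult_mat4_index[OF magic_carrier givens_carrier ij]
    using less4_cases[OF ij(1)] less4_cases[OF ij(2)]
    by (elim disjE)
      (simp_all add: kron_bit_def magic_def givens_def phase_x_def bit_evals complex_eq_iff
        assms cos_sin_sq algebra_simps)
qed (simp_all add: mult_carrier_mat[of _ 4 4 _ 4])

lemma local_givens:
  assumes "k < 3"
  shows "local_in_magic (givens k t)"
proof -
  from assms have "k = 0 \<or> k = 1 \<or> k = 2" by auto
  then show ?thesis
    using kron_phase_x_magic[of t "t / 2"] kron_phase_z_magic[of t "t / 2"]
      kron_phase_x_conj_magic[of t "t / 2"] unitary_phase_x unitary_phase_z
      cos_double[of "t / 2"] sin_double[of "t / 2"]
    unfolding local_in_magic_def by (auto simp: power2_eq_square)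
qed

text \<open>Equality of adjoint and transpose says that the entries are real. Locality is recorded
  for the transpose too because one of the two rotations enters the decomposition
  transposed.\<close>

definition rotation4 :: "complex mat \<Rightarrow> bool" where
  "rotation4 R \<longleftrightarrow> R \<in> carrier_mat 4 4 \<and> adj R = transpose_mat R \<and> transpose_mat R * R = 1\<^sub>m 4 \<and>
    local_in_magic R \<and> local_in_magic (transpose_mat R)"

lemma transpose_givens: "k < 3 \<Longrightarrow> transpose_mat (givens k t) = givens k (- t)"
  by (rule eq_matI) (auto simp: givens_def)

lemma rotation4_givens:
  assumes "k < 3"
  shows "rotation4 (givens k t)"
proof -
  have "adj (givens k t) = transpose_mat (givens k t)"
    by (rule eq_matI) (auto simp: givens_def adj_def)
  moreover have "givens k (- t) * givens k t = 1\<^sub>m 4"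
  proof (rule eq_mat4I)
    fix i j :: nat assume ij: "i < 4" "j < 4"
    have "k = 0 \<or> k = 1 \<or> k = 2" using assms by auto
    then show "(givens k (- t) * givens k t) $$ (i, j) = 1\<^sub>m 4 $$ (i, j)"
      unfolding mult_mat4_index[OF givens_carrier givens_carrier ij]
      using less4_cases[OF ij(1)] less4_cases[OF ij(2)]
      by (elim disjE) (simp_all add: givens_def complex_eq_iff cos_sin_sq)
  qed (simp_all add: mult_carrier_mat[of _ 4 4 _ 4])
  ultimately show ?thesis
    using assms by (simp add: rotation4_def transpose_givens local_givens)
qed

lemma rotation4_mult:
  assumes R: "rotation4 R" and R': "rotation4 R'"
  shows "rotation4 (R * R')"
proof -
  from R R' have car: "R \<in> carrier_mat 4 4" "R' \<in> carrier_mat 4 4"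
    "transpose_mat R \<in> carrier_mat 4 4" "transpose_mat R' \<in> carrier_mat 4 4"
    by (simp_all add: rotation4_def)
  have t: "transpose_mat (R * R') = transpose_mat R' * transpose_mat R"
    using car by (intro transpose_mult)
  have "transpose_mat R' * transpose_mat R * (R * R') = transpose_mat R' * (transpose_mat R * R * R')"
    using car by (simp add: assoc_mult_mat[of _ 4 4 _ 4 _ 4])
  also have "\<dots> = 1\<^sub>m 4"
    using R R' car by (simp add: rotation4_def)
  finally show ?thesis
    using R R' car by (auto simp: rotation4_def t adj_mult local_in_magic_mult)
qed

lemma givens_unit_vec:
  assumes "k < 3"
  shows "givens k t *\<^sub>v unit_vec 4 k = of_real (cos t) \<cdot>\<^sub>v unit_vec 4 k + of_real (sin t) \<cdot>\<^sub>v unit_vec 4 (Suc k)"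
    and "i < k \<Longrightarrow> givens k t *\<^sub>v unit_vec 4 i = unit_vec 4 i"
  using assms by (auto intro!: eq_vecI simp: givens_def)

text \<open>Spherical coordinates: w = cos t e_k + sin t w' with a unit vector w' supported beyond
  \<open>k\<close>. The Givens rotation sends e_k to cos t e_k + sin t e_(k+1), and the rotation
  \<open>R\<close> obtained for \<open>Suc k\<close> then fixes e_k and moves e_(k+1) to w'.\<close>

lemma rotation4_column:
  fixes w :: "nat \<Rightarrow> real"
  assumes "k < 3" "(\<Sum>i<4. (w i)\<^sup>2) = 1" "\<And>i. i < k \<Longrightarrow> w i = 0"
  shows "\<exists>R. rotation4 R \<and> (\<forall>i<k. R *\<^sub>v unit_vec 4 i = unit_vec 4 i) \<and>
    R *\<^sub>v unit_vec 4 k = vec 4 (\<lambda>i. of_real (w i))"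
  using assms
proof (induction "2 - k" arbitrary: k w)
  case 0
  then have k: "k = 2" by simp
  have "{..<4::nat} = {0, 1, 2, 3}" by auto
  then have "(w 2)\<^sup>2 + (w 3)\<^sup>2 = 1" using 0 k by simp
  then obtain t where t: "w 2 = cos t" "w 3 = sin t" using sincos_total_2pi by metis
  have "givens 2 t *\<^sub>v unit_vec 4 2 = vec 4 (\<lambda>i. of_real (w i))"
    unfolding givens_unit_vec(1)[of 2, simplified]
  proof (rule eq_vecI)
    fix i assume "i < dim_vec (vec 4 (\<lambda>i. complex_of_real (w i)))"
    then show "(of_real (cos t) \<cdot>\<^sub>v unit_vec 4 2 + of_real (sin t) \<cdot>\<^sub>v unit_vec 4 3) $ i
        = vec 4 (\<lambda>i. complex_of_real (w i)) $ i"
      using less4_cases[of i] 0 k t by auto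
  qed simp
  then show ?case using k rotation4_givens[of 2 t] givens_unit_vec(2)[of 2 _ t] by auto
next
  case (Suc n)
  then have k: "k < 2" and n: "n = 2 - Suc k" by auto
  define \<rho> where "\<rho> = sqrt (\<Sum>i\<in>{Suc k..<4}. (w i)\<^sup>2)"
  have \<rho>2: "\<rho>\<^sup>2 = (\<Sum>i\<in>{Suc k..<4}. (w i)\<^sup>2)"
    unfolding \<rho>_def by (intro real_sqrt_pow2 sum_nonneg) auto
  have split: "(\<Sum>i<4. g i) = (\<Sum>i<k. g i) + (g k + (\<Sum>i\<in>{Suc k..<4}. g i))" for g :: "nat \<Rightarrow> real"
  proof -
    have "k = 0 \<or> k = 1" using k by auto
    then show ?thesis by (auto simp: numeral_eq_Suc)
  qed
  have "(w k)\<^sup>2 + \<rho>\<^sup>2 = 1" using Suc.prems(2,3) unfolding split \<rho>2 by simp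
  then obtain t where t: "w k = cos t" "\<rho> = sin t" using sincos_total_2pi by metis
  \<comment> \<open>If nothing of \<open>w\<close> lies beyond \<open>k\<close>, any unit vector
    will do as the direction; the next basis vector is taken.\<close>
  define w' where "w' i = (if i \<le> k then 0 else if \<rho> = 0 then (if i = Suc k then 1 else 0) else w i / \<rho>)" for i
  have \<rho>w: "\<rho> * w' i = w i" if "k < i" "i < 4" for i
  proof (cases "\<rho> = 0")
    case True
    then have "(w i)\<^sup>2 = 0"
      using \<rho>2 that by (simp add: sum_nonneg_eq_0_iff)
    then show ?thesis using True by simp
  qed (use that in \<open>simp add: w'_def\<close>)
  have "(\<Sum>i\<in>{Suc k..<4}. (w' i)\<^sup>2) = 1"
  proof (cases "\<rho> = 0")
    case True
    have "(\<Sum>i\<in>{Suc k..<4}. (w' i)\<^sup>2) = (\<Sum>i\<in>{Suc k..<4}. if i = Suc k then 1 else 0)"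
      using True by (intro sum.cong) (auto simp: w'_def)
    also have "\<dots> = 1" using k by simp
    finally show ?thesis .
  next
    case False
    have "(\<Sum>i\<in>{Suc k..<4}. (w' i)\<^sup>2) = (\<Sum>i\<in>{Suc k..<4}. (w i)\<^sup>2 / \<rho>\<^sup>2)"
      using False by (intro sum.cong) (auto simp: w'_def power_divide)
    also have "\<dots> = 1" using False by (simp add: \<rho>2[symmetric] sum_divide_distrib[symmetric])
    finally show ?thesis .
  qed
  then have "(\<Sum>i<4. (w' i)\<^sup>2) = 1" unfolding split by (simp add: w'_def)
  then obtain R where R: "rotation4 R" "\<And>i. i < Suc k \<Longrightarrow> R *\<^sub>v unit_vec 4 i = unit_vec 4 i"
    "R *\<^sub>v unit_vec 4 (Suc k) = vec 4 (\<lambda>i. of_real (w' i))"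
    using Suc.hyps(1)[OF n, of w'] k by (auto simp: w'_def)
  have car: "R \<in> carrier_mat 4 4" using R(1) by (simp add: rotation4_def)
  have "R * givens k t *\<^sub>v unit_vec 4 i = unit_vec 4 i" if "i < k" for i
    using that k car R(2) by (simp add: assoc_mult_mat_vec[of _ 4 4 _ 4] givens_unit_vec(2))
  moreover have "R * givens k t *\<^sub>v unit_vec 4 k = vec 4 (\<lambda>i. of_real (w i))"
  proof -
    have "R * givens k t *\<^sub>v unit_vec 4 k =
        of_real (cos t) \<cdot>\<^sub>v unit_vec 4 k + of_real (sin t) \<cdot>\<^sub>v vec 4 (\<lambda>i. of_real (w' i))"
      using k car R(2)[of k] R(3)
      by (simp add: assoc_mult_mat_vec[of _ 4 4 _ 4] givens_unit_vec(1) mult_add_distrib_mat_vec[of _ 4 4]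
          mult_mat_vec[of _ 4 4])
    also have "\<dots> = vec 4 (\<lambda>i. of_real (w i))"
    proof (rule eq_vecI)
      fix i assume "i < dim_vec (vec 4 (\<lambda>i. complex_of_real (w i)))"
      then have i: "i < 4" by simp
      have "w i = cos t * (if i = k then 1 else 0) + sin t * w' i"
        using \<rho>w[of i] i t Suc.prems(3)[of i] by (cases i k rule: linorder_cases) (auto simp: w'_def)
      then show "(of_real (cos t) \<cdot>\<^sub>v unit_vec 4 k + of_real (sin t) \<cdot>\<^sub>v vec 4 (\<lambda>i. of_real (w' i))) $ i
          = vec 4 (\<lambda>i. complex_of_real (w i)) $ i"
        using i k by simp
    qed simp
    finally show ?thesis .
  qed
  ultimately show ?case
    using rotation4_mult[OF R(1) rotation4_givens[of k t]] k by auto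
qed

section \<open>Diagonalisation and reduction by rotations\<close>

lemma inverse_cancel_left:
  assumes "A * B = 1\<^sub>m n" "A \<in> carrier_mat n n" "B \<in> carrier_mat n n" "X \<in> carrier_mat n m"
  shows "A * (B * X) = (X :: complex mat)"
  using assms by (metis assoc_mult_mat left_mult_one_mat)

lemma inverse_cancel_left_vec:
  assumes "A * B = 1\<^sub>m n" "A \<in> carrier_mat n n" "B \<in> carrier_mat n n" "x \<in> carrier_vec n"
  shows "A *\<^sub>v (B *\<^sub>v x) = (x :: complex vec)"
  using assms by (metis assoc_mult_mat_vec one_mult_mat_vec)

lemmas mat4_simps = assoc_mult_mat[of _ 4 4 _ 4 _ 4] mult_carrier_mat[of _ 4 4 _ 4]
  inverse_cancel_left[of _ _ 4 _ 4]

lemma rotation4D: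
  assumes "rotation4 R"
  shows "R \<in> carrier_mat 4 4" "transpose_mat R \<in> carrier_mat 4 4" "adj R = transpose_mat R"
    "transpose_mat R * R = 1\<^sub>m 4" "R * transpose_mat R = 1\<^sub>m 4" "adj (transpose_mat R) = R"
proof -
  show 1: "R \<in> carrier_mat 4 4" "transpose_mat R \<in> carrier_mat 4 4" "adj R = transpose_mat R"
    "transpose_mat R * R = 1\<^sub>m 4" using assms by (auto simp: rotation4_def)
  show "R * transpose_mat R = 1\<^sub>m 4" using 1 by (metis mat_mult_left_right_inverse)
  show "adj (transpose_mat R) = R" using 1(3) by (metis adj_adj)
qed

lemma rotation4_fixes_transpose:
  assumes "rotation4 R" "R *\<^sub>v x = y" "x \<in> carrier_vec 4"
  shows "transpose_mat R *\<^sub>v y = x"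
  using assms rotation4D[OF assms(1)] by (metis inverse_cancel_left_vec)

text \<open>For real orthogonal \<open>R\<close> congruence and unitary conjugation are the same
  map; the former preserves symmetry, the latter unitarity.\<close>

lemma rotate_symmetric_unitary:
  assumes S: "S \<in> carrier_mat 4 4" "transpose_mat S = S" "adj S * S = 1\<^sub>m 4" and R: "rotation4 R"
  defines "S' \<equiv> transpose_mat R * (S * R)"
  shows "S' \<in> carrier_mat 4 4" "transpose_mat S' = S'" "adj S' * S' = 1\<^sub>m 4"
proof -
  note R' = rotation4D[OF R]
  have adjS: "adj S \<in> carrier_mat 4 4" using S(1) by simp
  show "S' \<in> carrier_mat 4 4" unfolding S'_def using S R' by (simp add: mat4_simps)
  show "transpose_mat S' = S'"
    unfolding S'_def using S R' by (simp add: transpose_mult[of _ 4 4 _ 4] mat4_simps)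
  show "adj S' * S' = 1\<^sub>m 4"
    unfolding S'_def using S R' adjS by (simp add: adj_mult[of _ 4 4 _ 4] mat4_simps)
qed

text \<open>Deflation: each round finds a real eigenvector orthogonal to the first \<open>k\<close>
  basis vectors and rotates e_k onto it while fixing those. Three rounds suffice, since
  \<open>diagonal4I\<close> takes care of the last column.\<close>

lemma rotation4_diagonalize_upto:
  assumes S: "S \<in> carrier_mat 4 4" "transpose_mat S = S" "adj S * S = 1\<^sub>m 4"
  shows "k \<le> 3 \<Longrightarrow> \<exists>R. rotation4 R \<and>
    (\<forall>i<k. \<exists>c. transpose_mat R * (S * R) *\<^sub>v unit_vec 4 i = c \<cdot>\<^sub>v unit_vec 4 i)"
proof (induction k)
  case 0
  then show ?case using rotation4_givens[of 0 0] by auto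
next
  case (Suc k)
  then obtain R where R: "rotation4 R"
    and eig: "\<And>i. i < k \<Longrightarrow> \<exists>c. transpose_mat R * (S * R) *\<^sub>v unit_vec 4 i = c \<cdot>\<^sub>v unit_vec 4 i"
    by auto
  define S' where "S' = transpose_mat R * (S * R)"
  note S' = rotate_symmetric_unitary[OF S R, folded S'_def]
  have "k < 4" "k < 3" using Suc.prems by auto
  obtain w \<mu> where w: "(\<Sum>i<4. (w i)\<^sup>2) = 1"
    "S' *\<^sub>v vec 4 (\<lambda>i. of_real (w i)) = \<mu> \<cdot>\<^sub>v vec 4 (\<lambda>i. of_real (w i))"
    "\<And>i. i < k \<Longrightarrow> w i = 0"
    using symmetric_unitary_block_real_eigenvector[OF S' \<open>k < 4\<close> eig[folded S'_def]] by metis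
  obtain R' where R': "rotation4 R'" and fixed: "\<And>i. i < k \<Longrightarrow> R' *\<^sub>v unit_vec 4 i = unit_vec 4 i"
    and col: "R' *\<^sub>v unit_vec 4 k = vec 4 (\<lambda>i. of_real (w i))"
    using rotation4_column[OF \<open>k < 3\<close> w(1,3)] by blast
  note car = rotation4D(1,2)[OF R] rotation4D(1,2)[OF R'] S(1) S'(1)
  have eq: "transpose_mat (R * R') * (S * (R * R')) = transpose_mat R' * (S' * R')"
    unfolding S'_def using car by (simp add: transpose_mult[of _ 4 4 _ 4] mat4_simps)
  \<comment> \<open>Used with the new eigenvector for i = k, and with x = e_i for the earlier
    indices.\<close>
  have transfer: "transpose_mat R' * (S' * R') *\<^sub>v unit_vec 4 i = c \<cdot>\<^sub>v unit_vec 4 i"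
    if "R' *\<^sub>v unit_vec 4 i = x" "S' *\<^sub>v x = c \<cdot>\<^sub>v x" for i x c
  proof -
    have x: "x \<in> carrier_vec 4" using that(1) car by auto
    have "transpose_mat R' * (S' * R') *\<^sub>v unit_vec 4 i = transpose_mat R' *\<^sub>v (S' *\<^sub>v (R' *\<^sub>v unit_vec 4 i))"
      using car by (simp add: assoc_mult_mat_vec[of _ 4 4 _ 4] mult_carrier_mat[of _ 4 4 _ 4])
    also have "\<dots> = c \<cdot>\<^sub>v (transpose_mat R' *\<^sub>v x)"
      using that x car by (simp add: mult_mat_vec[of _ 4 4])
    also have "transpose_mat R' *\<^sub>v x = unit_vec 4 i"
      using rotation4_fixes_transpose[OF R' that(1)] by simp
    finally show ?thesis .
  qed
  have "\<exists>c. transpose_mat (R * R') * (S * (R * R')) *\<^sub>v unit_vec 4 i = c \<cdot>\<^sub>v unit_vec 4 i" if "i < Suc k" for i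
  proof (cases "i = k")
    case True
    then show ?thesis unfolding eq using transfer[OF col w(2)] by blast
  next
    case False
    then show ?thesis unfolding eq
      using that transfer[OF fixed] eig[folded S'_def] by (metis less_Suc_eq)
  qed
  then show ?case using rotation4_mult[OF R R'] by blast
qed

text \<open>An off-diagonal entry of the last column lies in one of the first three rows, which are
  columns of the transpose.\<close>

lemma diagonal4I:
  fixes M :: "complex mat"
  assumes "M \<in> carrier_mat 4 4"
    and "\<And>i. i < 3 \<Longrightarrow> \<exists>c. M *\<^sub>v unit_vec 4 i = c \<cdot>\<^sub>v unit_vec 4 i"
    and "\<And>i. i < 3 \<Longrightarrow> \<exists>c. transpose_mat M *\<^sub>v unit_vec 4 i = c \<cdot>\<^sub>v unit_vec 4 i"
  shows "diagonal_mat M"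
  unfolding diagonal_mat_def
proof (intro allI impI)
  fix i j assume ij: "i < dim_row M" "j < dim_col M" "i \<noteq> j"
  have col: "A $$ (i, j) = 0" if "A \<in> carrier_mat 4 4" "A *\<^sub>v unit_vec 4 j = c \<cdot>\<^sub>v unit_vec 4 j"
    "i < 4" "j < 4" "i \<noteq> j" for A :: "complex mat" and c i j
  proof -
    have "A $$ (i, j) = (A *\<^sub>v unit_vec 4 j) $ i"
      using that(1,3,4) by (simp add: scalar_prod_right_unit)
    then show ?thesis using that by simp
  qed
  show "M $$ (i, j) = 0"
  proof (cases "j < 3")
    case True
    then show ?thesis using ij assms(1,2) col[of M j _ i] by auto
  next
    case False
    then have "i < 3" using ij assms(1) by auto
    then have "transpose_mat M $$ (j, i) = 0"
      using ij assms(1,3) col[of "transpose_mat M" i _ j] by auto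
    then show ?thesis using ij by simp
  qed
qed

text \<open>The QR reduction with rotations only. The last column is left alone, because a
  reflection cannot be turned into the identity by rotations.\<close>

lemma rotation4_reduce_orthogonal:
  assumes V: "V \<in> carrier_mat 4 4" "adj V = transpose_mat V" "transpose_mat V * V = 1\<^sub>m 4"
  shows "k \<le> 3 \<Longrightarrow> \<exists>R. rotation4 R \<and> (\<forall>i<k. transpose_mat R * V *\<^sub>v unit_vec 4 i = unit_vec 4 i)"
proof (induction k)
  case 0
  then show ?case using rotation4_givens[of 0 0] by auto
next
  case (Suc k)
  then obtain R where R: "rotation4 R"
    and fixR: "\<And>i. i < k \<Longrightarrow> transpose_mat R * V *\<^sub>v unit_vec 4 i = unit_vec 4 i"
    by auto
  define V' where "V' = transpose_mat R * V"
  note R_simps = rotation4D[OF R]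
  have V': "V' \<in> carrier_mat 4 4" using V(1) R_simps by (simp add: V'_def mat4_simps)
  have tV': "transpose_mat V' = transpose_mat V * R"
    using V(1) R_simps by (simp add: V'_def transpose_mult[of _ 4 4 _ 4])
  have aV': "adj V' = transpose_mat V'"
    unfolding tV' using V R_simps by (simp add: V'_def adj_mult[of _ 4 4 _ 4])
  have uV': "transpose_mat V' * V' = 1\<^sub>m 4"
    unfolding tV' unfolding V'_def using V R_simps by (simp add: mat4_simps)
  have k: "k < 3" "k < 4" using Suc.prems by auto
  define w where "w i = Re (V' $$ (i, k))" for i
  have real: "V' $$ (i, k) = of_real (w i)" if "i < 4" for i
  proof -
    have "cnj (V' $$ (i, k)) = adj V' $$ (k, i)" using V' that k by (simp add: adj_def)
    also have "\<dots> = V' $$ (i, k)" using V' that k by (simp add: aV')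
    finally show ?thesis by (simp add: w_def complex_eq_iff)
  qed
  have "(transpose_mat V' * V') $$ (k, k) = (\<Sum>i<4. of_real (w i) * of_real (w i))"
    using V' k by (simp add: scalar_prod_def atLeast0LessThan real)
  then have "complex_of_real (\<Sum>i<4. (w i)\<^sup>2) = 1"
    using k by (simp add: uV' power2_eq_square)
  then have w1: "(\<Sum>i<4. (w i)\<^sup>2) = 1"
    using of_real_eq_1_iff by blast
  \<comment> \<open>\<open>V'\<close> fixes e_i and is orthogonal, so its transpose fixes e_i as
    well and row \<open>i\<close> vanishes off the diagonal.\<close>
  have w0: "w i = 0" if "i < k" for i
  proof -
    have "transpose_mat V' *\<^sub>v unit_vec 4 i = transpose_mat V' *\<^sub>v (V' *\<^sub>v unit_vec 4 i)"
      using fixR[OF that] by (simp add: V'_def)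
    also have "\<dots> = unit_vec 4 i"
      using V' uV' by (simp add: inverse_cancel_left_vec[of _ _ 4])
    finally have "(transpose_mat V' *\<^sub>v unit_vec 4 i) $ k = 0" using that k by simp
    then have "V' $$ (i, k) = 0" using that k V' by (simp add: scalar_prod_right_unit)
    then show ?thesis by (simp add: w_def)
  qed
  have colV': "V' *\<^sub>v unit_vec 4 k = vec 4 (\<lambda>i. of_real (w i))"
    using V' k real by (intro eq_vecI) (auto simp: scalar_prod_right_unit)
  obtain R' where R': "rotation4 R'" and fixed: "\<And>i. i < k \<Longrightarrow> R' *\<^sub>v unit_vec 4 i = unit_vec 4 i"
    and col: "R' *\<^sub>v unit_vec 4 k = vec 4 (\<lambda>i. of_real (w i))"
    using rotation4_column[OF k(1) w1 w0] by blast
  note car = rotation4D(1,2)[OF R] rotation4D(1,2)[OF R'] V(1) V'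
  have eq: "transpose_mat (R * R') * V = transpose_mat R' * V'"
    unfolding V'_def using car by (simp add: transpose_mult[of _ 4 4 _ 4] mat4_simps)
  have transfer: "transpose_mat R' * V' *\<^sub>v unit_vec 4 i = unit_vec 4 i"
    if "R' *\<^sub>v unit_vec 4 i = V' *\<^sub>v unit_vec 4 i" for i
  proof -
    have "transpose_mat R' * V' *\<^sub>v unit_vec 4 i = transpose_mat R' *\<^sub>v (V' *\<^sub>v unit_vec 4 i)"
      using car by (simp add: assoc_mult_mat_vec[of _ 4 4 _ 4])
    then show ?thesis using rotation4_fixes_transpose[OF R' that] by simp
  qed
  have "transpose_mat (R * R') * V *\<^sub>v unit_vec 4 i = unit_vec 4 i" if "i < Suc k" for i
    unfolding eq using that fixed fixR[folded V'_def] col colV'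
    by (intro transfer) (auto simp: less_Suc_eq)
  then show ?case using rotation4_mult[OF R R'] by blast
qed

section \<open>The Cartan decomposition\<close>

lemma magic_unitary: "adj magic * magic = 1\<^sub>m 4" "magic * adj magic = 1\<^sub>m 4"
proof -
  have adj: "adj magic \<in> carrier_mat 4 4" by simp
  show *: "adj magic * magic = 1\<^sub>m 4"
  proof (rule eq_mat4I)
    fix i j :: nat assume ij: "i < 4" "j < 4"
    show "(adj magic * magic) $$ (i, j) = 1\<^sub>m 4 $$ (i, j)"
      unfolding mult_mat4_index[OF adj magic_carrier ij]
      using less4_cases[OF ij(1)] less4_cases[OF ij(2)]
      by (elim disjE) (simp_all add: magic_def adj_def algebra_simps)
  qed (simp_all add: mult_carrier_mat[of _ 4 4 _ 4])
  show "magic * adj magic = 1\<^sub>m 4"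
    using mat_mult_left_right_inverse[OF adj magic_carrier *] .
qed

section \<open>Diagonal unitary matrices\<close>

lemma diagonal_transpose:
  assumes "diagonal_mat E" "E \<in> carrier_mat n n"
  shows "transpose_mat E = E"
proof (rule eq_matI)
  fix i j assume "i < dim_row E" "j < dim_col E"
  then show "transpose_mat E $$ (i, j) = E $$ (i, j)"
    using assms by (cases "i = j") (auto simp: diagonal_mat_def)
qed (use assms(2) in auto)

lemma diagonal_unitary_entry:
  assumes "diagonal_mat E" "E \<in> carrier_mat n n" "adj E * E = 1\<^sub>m n" "i < n"
  shows "cnj (E $$ (i, i)) * E $$ (i, i) = 1"
proof -
  have "(adj E * E) $$ (i, i) = (\<Sum>j<n. cnj (E $$ (j, i)) * E $$ (j, i))"
    using assms(2,4) by (simp add: adj_def scalar_prod_def atLeast0LessThan)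
  also have "\<dots> = (\<Sum>j<n. if j = i then cnj (E $$ (i, i)) * E $$ (i, i) else 0)"
    using assms(1,2,4) by (intro sum.cong) (auto simp: diagonal_mat_def)
  finally show ?thesis using assms(3,4) by simp
qed

lemma diagonal_mult_index:
  assumes "diagonal_mat E" "E \<in> carrier_mat n n" "A \<in> carrier_mat n n" "i < n" "j < n"
  shows "(E * A) $$ (i, j) = E $$ (i, i) * (A $$ (i, j) :: complex)"
proof -
  have "(E * A) $$ (i, j) = (\<Sum>k<n. E $$ (i, k) * A $$ (k, j))"
    using assms(2-5) by (simp add: scalar_prod_def atLeast0LessThan)
  also have "\<dots> = (\<Sum>k<n. if k = i then E $$ (i, i) * A $$ (i, j) else 0)"
    using assms by (intro sum.cong) (auto simp: diagonal_mat_def)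
  finally show ?thesis using assms(4) by simp
qed

text \<open>Square roots are taken entry by entry; roots of numbers of modulus one have modulus one,
  whichever branch is chosen.\<close>

lemma diagonal_unitary_sqrt:
  assumes D: "diagonal_mat D" "D \<in> carrier_mat n n" "adj D * D = 1\<^sub>m n"
  obtains E where "diagonal_mat E" "E \<in> carrier_mat n n" "adj E * E = 1\<^sub>m n" "E * E = D"
proof
  define E where "E = mat n n (\<lambda>(i, j). if i = j then csqrt (D $$ (i, i)) else 0)"
  show E: "diagonal_mat E" "E \<in> carrier_mat n n"
    by (auto simp: E_def diagonal_mat_def)
  show "E * E = D"
  proof (rule eq_matI)
    fix i j assume "i < dim_row D" "j < dim_col D"
    then show "(E * E) $$ (i, j) = D $$ (i, j)"
      using E D(1,2)
      by (subst diagonal_mult_index[OF E E(2)])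
        (auto simp: E_def diagonal_mat_def simp flip: power2_eq_square)
  qed (use E(2) D(2) in auto)
  have adjE: "diagonal_mat (adj E)" "adj E \<in> carrier_mat n n"
    by (auto simp: E_def diagonal_mat_def adj_def)
  show "adj E * E = 1\<^sub>m n"
  proof (rule eq_matI)
    fix i j assume "i < dim_row (1\<^sub>m n :: complex mat)" "j < dim_col (1\<^sub>m n :: complex mat)"
    then have ij: "i < n" "j < n" by auto
    have "complex_of_real ((cmod (D $$ (i, i)))\<^sup>2) = 1"
      using diagonal_unitary_entry[OF D ij(1)] by (simp only: complex_norm_square mult.commute)
    then have "(cmod (D $$ (i, i)))\<^sup>2 = 1" using of_real_eq_1_iff by blast
    then have "cmod (D $$ (i, i)) = 1"
      using norm_ge_zero[of "D $$ (i, i)"] by (auto simp: power2_eq_1_iff)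
    then have "(cmod (csqrt (D $$ (i, i))))\<^sup>2 = 1"
      by (metis norm_power power2_csqrt)
    then have "cnj (csqrt (D $$ (i, i))) * csqrt (D $$ (i, i)) = 1"
      by (metis complex_norm_square mult.commute of_real_1)
    then show "(adj E * E) $$ (i, j) = 1\<^sub>m n $$ (i, j)"
      using ij by (cases "i = j") (simp_all add: diagonal_mult_index[OF adjE E(2)], simp_all add: E_def adj_def)
  qed (simp_all add: adj_def E_def)
qed

lemma diagonal_mult:
  assumes "diagonal_mat A" "diagonal_mat B" "A \<in> carrier_mat n n" "B \<in> carrier_mat n n"
  shows "diagonal_mat (A * B :: complex mat)"
  using assms by (auto simp: diagonal_mat_def[of "A * B"] diagonal_mult_index simp del: index_mult_mat(1))
    (auto simp: diagonal_mat_def)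

text \<open>In the magic basis U becomes W. If R diagonalises \<open>W^T W\<close> to
  \<open>E^2\<close>, then V = W R \<open>E^-1\<close> satisfies V^T V = 1 and is unitary, hence
  real orthogonal. So V = R' J with diagonal J, and W = R' (J E) R^T, where R' and R^T are
  local.\<close>

lemma magic_cartan_decomposition:
  assumes "unitary4 U"
  obtains A B C D E where "unitary_bit A" "unitary_bit B" "unitary_bit C" "unitary_bit D"
    "diagonal_mat E" "E \<in> carrier_mat 4 4" "adj E * E = 1\<^sub>m 4"
    "U = kron_bit A B * (magic * (E * (adj magic * kron_bit C D)))"
proof -
  have U: "U \<in> carrier_mat 4 4" "adj U \<in> carrier_mat 4 4" "adj U * U = 1\<^sub>m 4"
    using assms by (auto simp: unitary4_def)
  define Q where "Q = magic"
  have Q: "Q \<in> carrier_mat 4 4" "adj Q \<in> carrier_mat 4 4" "adj Q * Q = 1\<^sub>m 4" "Q * adj Q = 1\<^sub>m 4"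
    using magic_unitary by (simp_all add: Q_def)
  define W where "W = adj Q * (U * Q)"
  have W: "W \<in> carrier_mat 4 4" "adj W \<in> carrier_mat 4 4" "transpose_mat W \<in> carrier_mat 4 4"
    using U Q by (simp_all add: W_def mat4_simps)
  have aW: "adj W * W = 1\<^sub>m 4"
    unfolding W_def using U Q by (simp add: adj_mult[of _ 4 4 _ 4] mat4_simps)
  have Wa: "W * adj W = 1\<^sub>m 4"
    using mat_mult_left_right_inverse[OF W(2,1) aW] .
  have taW: "transpose_mat (adj W) = adj (transpose_mat W)"
    using W by (intro eq_matI) (auto simp: adj_def)
  have "transpose_mat (adj W * W) = 1\<^sub>m 4" unfolding aW by simp
  moreover have "transpose_mat (adj W * W) = transpose_mat W * adj (transpose_mat W)"
    using W taW by (simp add: transpose_mult[of _ 4 4 _ 4])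
  ultimately have tW': "transpose_mat W * adj (transpose_mat W) = 1\<^sub>m 4" by simp
  have tW: "adj (transpose_mat W) * transpose_mat W = 1\<^sub>m 4"
    using mat_mult_left_right_inverse[OF W(3) _ tW'] W by simp
  define S where "S = transpose_mat W * W"
  have S: "S \<in> carrier_mat 4 4" "transpose_mat S = S" "adj S * S = 1\<^sub>m 4"
    unfolding S_def using W aW tW
    by (simp_all add: transpose_mult[of _ 4 4 _ 4] adj_mult[of _ 4 4 _ 4] mat4_simps)
  obtain R where R: "rotation4 R"
    and eig: "\<And>i. i < 3 \<Longrightarrow> \<exists>c. transpose_mat R * (S * R) *\<^sub>v unit_vec 4 i = c \<cdot>\<^sub>v unit_vec 4 i"
    using rotation4_diagonalize_upto[OF S, of 3] by auto
  note R_simps = rotation4D[OF R]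
  define G where "G = transpose_mat R * (S * R)"
  note G = rotate_symmetric_unitary[OF S R, folded G_def]
  have "diagonal_mat G"
    using diagonal4I[OF G(1)] G(2) eig[folded G_def] by simp
  then obtain E where E: "diagonal_mat E" "E \<in> carrier_mat 4 4" "adj E * E = 1\<^sub>m 4" "E * E = G"
    using diagonal_unitary_sqrt[OF _ G(1,3)] by metis
  have aE: "adj E \<in> carrier_mat 4 4" "transpose_mat (adj E) = adj E" "E * adj E = 1\<^sub>m 4"
  proof -
    show *: "adj E \<in> carrier_mat 4 4" using E(2) by simp
    have "diagonal_mat (adj E)" using E(1,2) by (auto simp: diagonal_mat_def adj_def)
    then show "transpose_mat (adj E) = adj E" using * by (rule diagonal_transpose)
    show "E * adj E = 1\<^sub>m 4" using mat_mult_left_right_inverse[OF * E(2,3)] .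
  qed
  define V where "V = W * (R * adj E)"
  have V: "V \<in> carrier_mat 4 4" "adj V \<in> carrier_mat 4 4" "transpose_mat V \<in> carrier_mat 4 4"
    unfolding V_def using W R_simps aE by (simp_all add: mat4_simps)
  have "transpose_mat V * V = adj E * (G * adj E)"
    unfolding V_def G_def S_def using W R_simps aE
    by (simp add: transpose_mult[of _ 4 4 _ 4] mat4_simps)
  also have "\<dots> = 1\<^sub>m 4"
    unfolding E(4)[symmetric] using E(1-3) aE by (simp add: mat4_simps)
  finally have tV: "transpose_mat V * V = 1\<^sub>m 4" .
  have "adj V * V = 1\<^sub>m 4"
    unfolding V_def using W aW R_simps E aE
    by (simp add: adj_mult[of _ 4 4 _ 4] mat4_simps)
  then have "V * adj V = 1\<^sub>m 4"
    using mat_mult_left_right_inverse[OF V(2,1)] by simp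
  \<comment> \<open>Adjoint and transpose are both inverses of \<open>V\<close>, hence equal; this
    is how realness of \<open>V\<close> is obtained.\<close>
  then have aV: "adj V = transpose_mat V"
    using inverse_cancel_left[OF tV V(3,1,2)] V by simp
  obtain R' where R': "rotation4 R'"
    and fixed: "\<And>i. i < 3 \<Longrightarrow> transpose_mat R' * V *\<^sub>v unit_vec 4 i = unit_vec 4 i"
    using rotation4_reduce_orthogonal[OF V(1) aV tV, of 3] by auto
  note R'_simps = rotation4D[OF R']
  define J where "J = transpose_mat R' * V"
  have J: "J \<in> carrier_mat 4 4" "transpose_mat J \<in> carrier_mat 4 4" "adj J \<in> carrier_mat 4 4"
    unfolding J_def using V R'_simps by (simp_all add: mat4_simps)
  have tJ: "transpose_mat J * J = 1\<^sub>m 4"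
    unfolding J_def using V R'_simps tV by (simp add: transpose_mult[of _ 4 4 _ 4] mat4_simps)
  have aJ: "adj J * J = 1\<^sub>m 4"
    unfolding J_def using V R'_simps tV aV by (simp add: adj_mult[of _ 4 4 _ 4] mat4_simps)
  have "transpose_mat J *\<^sub>v unit_vec 4 i = unit_vec 4 i" if "i < 3" for i
    using inverse_cancel_left_vec[OF tJ J(2,1), of "unit_vec 4 i"] fixed[OF that] by (simp add: J_def)
  then have dJ: "diagonal_mat J"
    using fixed J(1) unfolding J_def[symmetric] by (intro diagonal4I) (metis one_smult_vec)+
  \<comment> \<open>The leftover \<open>J\<close>, possibly a reflection, joins the diagonal
    factor.\<close>
  define F where "F = J * E"
  have F: "F \<in> carrier_mat 4 4" "diagonal_mat F" "adj F * F = 1\<^sub>m 4"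
    unfolding F_def using J E aE aJ dJ
    by (simp_all add: adj_mult[of _ 4 4 _ 4] mat4_simps diagonal_mult[of _ _ 4])
  have "R' * (F * transpose_mat R) = R' * (transpose_mat R' * (W * (R * (adj E * (E * transpose_mat R)))))"
    unfolding F_def J_def V_def using R'_simps R_simps W E aE by (simp add: mat4_simps)
  also have "\<dots> = W"
    using R'_simps R_simps W E aE by (simp add: mat4_simps)
  finally have W_eq: "W = R' * (F * transpose_mat R)" ..
  obtain A B where AB: "unitary_bit A" "unitary_bit B" "kron_bit A B * Q = Q * R'"
    using R' unfolding rotation4_def local_in_magic_def Q_def by blast
  obtain C D where CD: "unitary_bit C" "unitary_bit D" "kron_bit C D * Q = Q * transpose_mat R"
    using R unfolding rotation4_def local_in_magic_def Q_def by blast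
  have "adj Q * (kron_bit C D * Q) * adj Q = adj Q * kron_bit C D"
    using Q by (simp add: mat4_simps right_mult_one_mat[of _ 4 4])
  then have right: "adj Q * kron_bit C D = transpose_mat R * adj Q"
    unfolding CD(3) using Q R_simps by (simp add: mat4_simps)
  have "U = Q * (W * adj Q)"
    unfolding W_def using U Q by (simp add: mat4_simps)
  also have "\<dots> = (Q * R') * (F * (transpose_mat R * adj Q))"
    unfolding W_eq using Q R_simps R'_simps F by (simp add: mat4_simps)
  also have "\<dots> = kron_bit A B * (Q * (F * (adj Q * kron_bit C D)))"
    unfolding AB(3)[symmetric] right[symmetric] using Q F by (simp add: mat4_simps)
  finally show thesis
    using that AB CD F unfolding Q_def by blast
qed

section \<open>Implementing an arbitrary two-qubit unitary\<close>

lemma mult_mat4_vec_index: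
  assumes "A \<in> carrier_mat 4 4" "v \<in> carrier_vec 4" "i < 4"
  shows "(A *\<^sub>v v) $ i = A $$ (i, 0) * v $ 0 + A $$ (i, 1) * v $ 1 + A $$ (i, 2) * v $ 2 +
    A $$ (i, 3) * (v $ 3 :: complex)"
  using assms by (simp add: scalar_prod_def atLeast0LessThan sum_less4)

lemma bit_amp_kron_bit:
  assumes "v \<in> carrier_vec 4"
  shows "bit_amp (kron_bit A B *\<^sub>v v) = apply_fst A (apply_snd B (bit_amp v))"
proof (intro ext)
  fix r r'
  show "bit_amp (kron_bit A B *\<^sub>v v) r r' = apply_fst A (apply_snd B (bit_amp v)) r r'"
    by (cases r; cases r')
      (simp_all add: bit_amp_simps mult_mat4_vec_index[OF kron_bit_carrier assms] del: index_mult_mat_vec,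
       simp_all add: kron_bit_def apply_fst_def apply_snd_def UNIV_bool bit_evals bit_amp_simps algebra_simps)
qed

text \<open>The columns \<open>0, 1, 2, 3\<close> of \<open>magic\<close> are, up to phases, the Bell states with parities
  \<open>(s, t) = (0, 0), (1, 0), (1, 1), (0, 1)\<close>.\<close>

definition bell_phases :: "complex mat \<Rightarrow> bool \<Rightarrow> bool \<Rightarrow> complex" where
  "bell_phases E s t = (let k = (if s then (if t then 2 else 1) else (if t then 3 else 0)) in E $$ (k, k))"

text \<open>Only the projectors onto the columns of \<open>magic\<close> enter, so the phases that
  distinguish these columns from Bell states cancel.\<close>

lemma bit_amp_magic_diagonal:
  assumes v: "v \<in> carrier_vec 4" and E: "diagonal_mat E" "E \<in> carrier_mat 4 4"
  shows "bit_amp (magic * (E * adj magic) *\<^sub>v v) = bell_diag (bell_phases E) (bit_amp v)"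
proof (intro ext)
  fix c c'
  have car: "adj magic \<in> carrier_mat 4 4" "E * adj magic \<in> carrier_mat 4 4"
    "magic * (E * adj magic) \<in> carrier_mat 4 4"
    using E(2) by (simp_all add: mult_carrier_mat[of _ 4 4 _ 4])
  have idx: "(magic * (E * adj magic)) $$ (i, j) =
      magic $$ (i, 0) * (E $$ (0, 0) * cnj (magic $$ (j, 0))) +
      magic $$ (i, 1) * (E $$ (1, 1) * cnj (magic $$ (j, 1))) +
      magic $$ (i, 2) * (E $$ (2, 2) * cnj (magic $$ (j, 2))) +
      magic $$ (i, 3) * (E $$ (3, 3) * cnj (magic $$ (j, 3)))" if "i < 4" "j < 4" for i j
  proof -
    have adj: "adj magic $$ (k, j) = cnj (magic $$ (j, k))" if "k < 4" for k
      using that \<open>j < 4\<close> by (simp add: adj_def magic_def)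
    show ?thesis
      unfolding mult_mat4_index[OF magic_carrier car(2) that]
      using that by (simp add: diagonal_mult_index[OF E car(1)] adj del: index_mult_mat(1))
  qed
  show "bit_amp (magic * (E * adj magic) *\<^sub>v v) c c' = bell_diag (bell_phases E) (bit_amp v) c c'"
    by (cases c; cases c')
      (simp_all add: bit_amp_simps mult_mat4_vec_index[OF car(3) v] idx del: index_mult_mat_vec index_mult_mat(1),
       simp_all add: magic_def bell_diag_def bell_phases_def bit_amp_simps UNIV_bool algebra_simps)
qed

lemma proj_smult: "proj (c \<cdot>\<^sub>v v) = (c * cnj c) \<cdot>\<^sub>m proj v"
  by (rule eq_matI) (auto simp: proj_def)

lemma run_butterfly_protocol_matrix:
  fixes A B C D E \<psi>
  assumes "diagonal_mat E" "E \<in> carrier_mat 4 4" "\<psi> \<in> carrier_vec 4"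
  defines "U \<equiv> kron_bit A B * (magic * (E * (adj magic * kron_bit C D)))"
  shows "run output_dims butterfly_dims (butterfly_protocol A B C D (bell_phases E))
    (proj (butterfly_init \<psi>)) = proj (U *\<^sub>v \<psi>)"
proof -
  have car: "adj magic \<in> carrier_mat 4 4" "E * adj magic \<in> carrier_mat 4 4"
    "magic * (E * adj magic) \<in> carrier_mat 4 4"
    using assms(2) by (simp_all add: mult_carrier_mat[of _ 4 4 _ 4])
  have U_eq: "U = kron_bit A B * ((magic * (E * adj magic)) * kron_bit C D)"
    unfolding U_def using assms(2) car(1) by (simp add: mat4_simps)
  have U: "U \<in> carrier_mat 4 4"
    unfolding U_eq using car by (simp add: mult_carrier_mat[of _ 4 4 _ 4])
  have v1: "kron_bit C D *\<^sub>v \<psi> \<in> carrier_vec 4"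
    by (rule mult_mat_vec_carrier[OF kron_bit_carrier assms(3)])
  have v2: "magic * (E * adj magic) *\<^sub>v (kron_bit C D *\<^sub>v \<psi>) \<in> carrier_vec 4"
    by (rule mult_mat_vec_carrier[OF car(3) v1])
  have "U *\<^sub>v \<psi> = kron_bit A B *\<^sub>v (magic * (E * adj magic) *\<^sub>v (kron_bit C D *\<^sub>v \<psi>))"
    unfolding U_eq using car(3) assms(3)
    by (simp add: assoc_mult_mat_vec[of _ 4 4 _ 4] mult_carrier_mat[of _ 4 4 _ 4])
  then have "bit_amp (U *\<^sub>v \<psi>) = apply_fst A (apply_snd B (bell_diag (bell_phases E)
      (apply_fst C (apply_snd D (bit_amp \<psi>)))))"
    using bit_amp_kron_bit[OF v2] bit_amp_magic_diagonal[OF v1 assms(1,2)] bit_amp_kron_bit[OF assms(3)]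
    by simp
  also have "apply_fst C (apply_snd D (bit_amp \<psi>)) = apply_snd D (apply_fst C (bit_amp \<psi>))"
    by (intro ext) (simp add: apply_fst_def apply_snd_def UNIV_bool algebra_simps)
  finally have amp: "apply_fst A (apply_snd B (bell_diag (bell_phases E)
      (apply_snd D (apply_fst C (bit_amp \<psi>))))) = bit_amp (U *\<^sub>v \<psi>)" ..
  have "tensor_vec output_dims (\<lambda>xs. root_half ^ 14 * bit_amp (U *\<^sub>v \<psi>) (bit (xs ! 4) 0) (bit (xs ! 5) 0))
      = root_half ^ 14 \<cdot>\<^sub>v (U *\<^sub>v \<psi>)"
  proof (rule eq_vecI)
    fix i assume "i < dim_vec (root_half ^ 14 \<cdot>\<^sub>v (U *\<^sub>v \<psi>))"
    then have "i < 4" using U by simp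
    then show "tensor_vec output_dims (\<lambda>xs. root_half ^ 14 * bit_amp (U *\<^sub>v \<psi>) (bit (xs ! 4) 0) (bit (xs ! 5) 0)) $ i
        = (root_half ^ 14 \<cdot>\<^sub>v (U *\<^sub>v \<psi>)) $ i"
      using less4_cases[OF \<open>i < 4\<close>] U
      by (elim disjE)
        (simp_all add: tensor_vec_def output_dims_def bit_amp_def bit_evals del: index_mult_mat_vec)
  qed (use U in \<open>simp add: output_dims_def\<close>)
  \<comment> \<open>The number of branches times the weight of each branch.\<close>
  moreover have "2 ^ 14 * (root_half ^ 14 * cnj (root_half ^ 14)) = 1"
    by (simp add: power_numeral_reduce)
  moreover have smult_smult: "c \<cdot>\<^sub>m (c' \<cdot>\<^sub>m M) = (c * c') \<cdot>\<^sub>m M" "1 \<cdot>\<^sub>m M = M"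
    for c c' and M :: "complex mat"
    by (auto intro!: eq_matI)
  ultimately show ?thesis
    using run_butterfly_protocol[of A B C D "bell_phases E" "bit_amp \<psi>"]
    unfolding amp butterfly_init_eq
    by (simp add: proj_smult smult_smult)
qed

theorem theorem3:
  fixes U :: "complex mat"
  assumes "unitary4 U"
  shows "deterministically_implementable U"
proof -
  obtain A B C D E where *: "unitary_bit A" "unitary_bit B" "unitary_bit C" "unitary_bit D"
    "diagonal_mat E" "E \<in> carrier_mat 4 4" "adj E * E = 1\<^sub>m 4"
    "U = kron_bit A B * (magic * (E * (adj magic * kron_bit C D)))"
    using magic_cartan_decomposition[OF assms] by metis
  have "cnj (bell_phases E s t) * bell_phases E s t = 1" for s t
    using diagonal_unitary_entry[OF *(5-7)] by (simp add: bell_phases_def Let_def)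
  then have "valid butterfly_dims (butterfly_protocol A B C D (bell_phases E)) output_dims"
    using * by (intro valid_butterfly_protocol) auto
  moreover have "run output_dims butterfly_dims (butterfly_protocol A B C D (bell_phases E))
      (proj (butterfly_init \<psi>)) = U * proj \<psi> * adj U" if "\<psi> \<in> carrier_vec 4" for \<psi>
  proof -
    have "U \<in> carrier_mat 4 (dim_vec \<psi>)" using assms that by (simp add: unitary4_def)
    then show ?thesis
      using run_butterfly_protocol_matrix[OF *(5,6) that, of A B C D] *(8) by (simp add: conj_proj)
  qed
  ultimately show ?thesis
    unfolding deterministically_implementable_def by blast
qed

end
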